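(* Let $d$ be a prime and $N\ge 1$ an integer. Fix $\theta_M\in[0,1]$ and let $P_{\theta_M}$ be the monitored-circuit Markov kernel on $\mathsf X=\mathbb{CP}^{d^N-1}$. Then: (i) (Existence) There exists a probability measure $\pi_{\theta_M}$ on $\mathsf X$ with $\pi_{\theta_M}P_{\theta_M}=\pi_{\theta_M}$. (ii) (Uniqueness) The invariant probability measure $\pi_{\theta_M}$ is unique (hence it does not depend on any initial law). (iii) ($W_1$-geometric convergence) There exist constants $C_{\theta_M}>0$ and $\lambda_{\theta_M}\in(0,1)$, depending on $\theta_M,d,N$ and the fixed local rotation family but not on the initial law, such that for every Borel probability measure $\mu$ on $\mathsf X$ and all $n\ge 0$, $$W_1\bigl(\mu P_{\theta_M}^{\,n},\pi_{\theta_M}\bigr)\le C_{\theta_M}\,\lambda_{\theta_M}^{\,n}.$$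
   Context: Let $d$ be prime, $N\ge1$, $D=d^N$, $\mathcal H=(\mathbb C^d)^{\otimes N}$, $\omega=e^{2\pi i/d}$, with computational basis $|m\rangle$, $m\in\mathbb F_d$ (field elements in exponents are replaced by their representatives in $\{0,\dots,d-1\}$). $\mathsf X=\mathbb P(\mathcal H)=\mathbb{CP}^{D-1}$ is the space of rays (pure states); $\rho_\psi=|\psi\rangle\langle\psi|$ for a unit representative. The metric is $d_{\mathrm{tr}}(\psi,\varphi)=\frac12\|\rho_\psi-\rho_\varphi\|_{1}=\sqrt{1-|\langle\psi,\varphi\rangle|^2}$ (trace norm), and $W_1$ is the Wasserstein-1 distance for $d_{\mathrm{tr}}$. On one qudit, $X|m\rangle=|m+1\rangle$, $Z|m\rangle=\omega^m|m\rangle$. The projective Pauli group is the group of classes in $PU(D)$ of the operators $\bigotimes_{j=1}^N Z^{p_j}X^{q_j}$, $(q,p)\in\mathbb F_d^{2N}$; the projective Clifford group $\mathcal C_{d,N}$ is its normalizer in $PU(D)$, a finite group. Its elements are identified with unitary representatives; all formulas are phase independent. Local rotation: $F_d=d^{-1/2}\sum_{j,k\in\mathbb F_d}\omega^{jk}|j\rangle\langle k|$. For $d=2$, $D_a^{(2)}(\theta)=\mathrm{diag}(1,e^{i\theta\pi/4})$; for $d=3$, $D_a^{(3)}(\theta)=\mathrm{diag}(1,e^{2\pi i\theta/9},e^{-2\pi i\theta/9})$; for $d>3$, with a fixed $a\in\mathbb F_d^*$, $D_a^{(d)}(\theta)=\sum_{k\in\mathbb F_d}e^{-2\pi i\theta\,\tau_{a,d}(k)/d}|k\rangle\langle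 k|$, where $\tau_{a,d}(k)\in\{0,\dots,d-1\}$ is the integer representative of $ak^3\in\mathbb F_d$. Set $R(\theta)=F_d^\dagger D_a^{(d)}(\theta)F_d$ and $R(\theta)^{(1)}=R(\theta)\otimes I^{\otimes(N-1)}$. Let $\Pi_m=|m\rangle\langle m|\otimes I^{\otimes(N-1)}$. For a branch $J=(U,m)\in\mathcal C_{d,N}\times\mathbb F_d$ put $p_{J,\theta}(\psi)=\|\Pi_mR(\theta)^{(1)}U|\psi\rangle\|^2$ and, when this is positive, $\Psi_{J,\theta}(\psi)=[\,U^\dagger\Pi_mR(\theta)^{(1)}U|\psi\rangle\,]\in\mathsf X$. The Markov kernel is $$P_{\theta_M}(\psi,A)=\frac1{|\mathcal C_{d,N}|}\sum_{J:\,p_{J,\theta_M}(\psi)>0}p_{J,\theta_M}(\psi)\,\mathbf 1_A(\Psi_{J,\theta_M}(\psi)),\qquad A\subset\mathsf X\text{ Borel},$$ and $\mu P_{\theta_M}$ denotes its action on probability measures. *)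

theory Defs
  imports
    "HOL-Probability.Probability"
    "HOL-Algebra.Group_Action"
    "Berlekamp_Zassenhaus.Finite_Field"
begin

section \<open>Complex matrices over a finite index type\<close>

definition cinner :: "complex^'i::finite \<Rightarrow> complex^'i \<Rightarrow> complex" where
  "cinner u v = (\<Sum>i\<in>UNIV. cnj (u $ i) * v $ i)"

definition adj :: "complex^'i^'j \<Rightarrow> complex^'j^'i" where
  "adj A = (\<chi> i j. cnj (A $ j $ i))"

definition outer :: "complex^'i \<Rightarrow> complex^'j \<Rightarrow> complex^'j^'i" where
  "outer u v = (\<chi> i j. u $ i * cnj (v $ j))"

definition psd :: "complex^'i^'i \<Rightarrow> bool" where
  "psd A \<longleftrightarrow> adj A = A \<and> (\<forall>v. 0 \<le> Re (cinner v (A *v v)))"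

definition psd_sqrt :: "complex^'i^'i \<Rightarrow> complex^'i^'i" where
  "psd_sqrt B = (THE S. psd S \<and> S ** S = B)"

definition trace_norm :: "complex^'i^'i \<Rightarrow> real" where
  "trace_norm A = Re (trace (psd_sqrt (adj A ** A)))"

text \<open>The type class operations \<open>*\<close> and \<open>^\<close> on vectors are componentwise, so powers of matrices
  are iterated from \<open>**\<close>.\<close>

definition matpow :: "complex^'i^'i \<Rightarrow> nat \<Rightarrow> complex^'i^'i" where
  "matpow A k = (((**) A) ^^ k) (mat 1)"


section \<open>Rays\<close>

lemma vector_smult_inverse:
  fixes u v :: "complex^'i"
  assumes "v = c *s u" "v \<noteq> 0"
  shows "u = inverse c *s v"
proof -
  have "c \<noteq> 0" using assms by auto
  then show ?thesis using assms(1) by (simp add: vec_eq_iff)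
qed

quotient_type 'i ray = "complex^'i::finite" / partial:
  "\<lambda>u v. u \<noteq> 0 \<and> v \<noteq> 0 \<and> (\<exists>c. v = c *s u)"
proof (rule part_equivpI)
  show "\<exists>x::complex^'i. x \<noteq> 0 \<and> x \<noteq> 0 \<and> (\<exists>c. x = c *s x)"
    by (rule exI[of _ "vec 1"]) (auto simp: vec_eq_iff intro!: exI[of _ 1])
  show "symp (\<lambda>u v::complex^'i. u \<noteq> 0 \<and> v \<noteq> 0 \<and> (\<exists>c. v = c *s u))"
    by (rule sympI) (use vector_smult_inverse in blast)
  show "transp (\<lambda>u v::complex^'i. u \<noteq> 0 \<and> v \<noteq> 0 \<and> (\<exists>c. v = c *s u))"
    by (rule transpI) (auto simp: vector_smult_assoc)
qed

abbreviation ray_of :: "complex^'i::finite \<Rightarrow> 'i ray" where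
  "ray_of \<equiv> abs_ray"

definition unit_rep :: "'i::finite ray \<Rightarrow> complex^'i" where
  "unit_rep x = (SOME v. norm v = 1 \<and> ray_of v = x)"

definition density :: "'i::finite ray \<Rightarrow> complex^'i^'i" where
  "density x = outer (unit_rep x) (unit_rep x)"

lemma unit_rep: "norm (unit_rep x) = 1" "ray_of (unit_rep x) = x"
proof -
  let ?u = "rep_ray x"
  have nz: "?u \<noteq> 0"
    using Quotient_rep_reflp[OF Quotient_ray] by blast
  let ?v = "complex_of_real (inverse (norm ?u)) *s ?u"
  have eq: "?v = inverse (norm ?u) *\<^sub>R ?u"
    by (simp add: vec_eq_iff) (simp add: scaleR_conv_of_real)
  have n: "norm ?v = 1" unfolding eq using nz by simp
  have "ray_of ?u = ray_of ?v"
    by (rule Quotient_rel_abs[OF Quotient_ray]) (use nz n in auto)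
  then have "ray_of ?v = x" using Quotient_abs_rep[OF Quotient_ray, of x] by simp
  with n have "norm (unit_rep x) = 1 \<and> ray_of (unit_rep x) = x"
    unfolding unit_rep_def by (intro someI[of "\<lambda>v. norm v = 1 \<and> ray_of v = x"]) simp
  then show "norm (unit_rep x) = 1" "ray_of (unit_rep x) = x" by auto
qed


subsection \<open>The trace distance\<close>

lemma matrix_diff_ldistrib: "A ** (B - C) = A ** B - A ** (C::complex^'i^'j)"
  by (simp add: vec_eq_iff matrix_matrix_mult_def sum_subtractf algebra_simps)

lemma matrix_diff_rdistrib: "(A - B) ** C = A ** C - B ** (C::complex^'i^'j)"
  by (simp add: vec_eq_iff matrix_matrix_mult_def sum_subtractf algebra_simps)

lemma matrix_plus_rdistrib: "(A + B) ** C = A ** C + B ** (C::complex^'i^'j)"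
  by (simp add: vec_eq_iff matrix_matrix_mult_def sum.distrib algebra_simps)

lemma matrix_scaleR_right: "A ** (r *\<^sub>R B) = r *\<^sub>R (A ** (B::complex^'i^'j))"
  by (simp add: vec_eq_iff matrix_matrix_mult_def scaleR_sum_right)

lemma matrix_scaleR_left: "(r *\<^sub>R A) ** B = r *\<^sub>R (A ** (B::complex^'i^'j))"
  by (simp add: vec_eq_iff matrix_matrix_mult_def scaleR_sum_right)

lemma adj_mult: "adj (A ** B) = adj B ** adj A"
  by (simp add: vec_eq_iff adj_def matrix_matrix_mult_def mult.commute)

lemma adj_diff: "adj (A - B) = adj A - adj B"
  by (simp add: vec_eq_iff adj_def)

lemma adj_scaleR: "adj (r *\<^sub>R A) = r *\<^sub>R adj A"
  by (simp add: vec_eq_iff adj_def)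

lemma adj_outer: "adj (outer u v) = outer v u"
  by (simp add: vec_eq_iff adj_def outer_def)

lemma cinner_self: "cinner v v = of_real ((norm v)\<^sup>2)"
proof -
  have "(norm v)\<^sup>2 = (\<Sum>i\<in>UNIV. (cmod (v $ i))\<^sup>2)"
    by (simp add: norm_vec_def L2_set_def sum_nonneg)
  then show ?thesis
    unfolding cinner_def by (simp add: complex_norm_square mult.commute del: of_real_power)
qed

lemma cinner_commute: "cinner v u = cnj (cinner u v)"
  by (simp add: cinner_def mult.commute)

lemma cinner_adj: "cinner u (A *v v) = cinner (adj A *v u) v"
  by (simp add: cinner_def adj_def matrix_vector_mult_def sum_distrib_left sum_distrib_right)
     (subst sum.swap, simp add: mult_ac)

lemma outer_mult: "outer a b ** outer c e = outer (cinner b c *s a) e"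
  by (simp add: vec_eq_iff outer_def matrix_matrix_mult_def cinner_def sum_distrib_right
      sum_distrib_left mult_ac)

lemma cinner_smult: "cinner b (c *s a) = c * cinner b a"
  by (simp add: cinner_def sum_distrib_left mult_ac)

lemma outer_smult_of_real: "outer (of_real r *s a) b = r *\<^sub>R outer a b"
  by (simp add: vec_eq_iff outer_def scaleR_conv_of_real[where 'a=complex] mult_ac)

lemma trace_outer: "trace (outer a b) = cinner b a"
  by (simp add: trace_def outer_def cinner_def mult.commute)

lemma trace_scaleR: "trace (r *\<^sub>R A) = of_real r * trace (A::complex^'i^'i)"
  by (simp add: trace_def sum_distrib_left scaleR_conv_of_real[where 'a=complex])

lemma trace_diff: "trace (A - B) = trace A - trace (B::complex^'i^'i)"
  by (simp add: trace_def sum_subtractf)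

lemma trace_add: "trace (A + B) = trace A + trace (B::complex^'i^'i)"
  by (simp add: trace_def sum.distrib)

lemma trace_adj_self: "trace (adj A ** A) = of_real (\<Sum>i\<in>UNIV. \<Sum>k\<in>UNIV. (cmod (A $ k $ i))\<^sup>2)"
  by (simp add: trace_def adj_def matrix_matrix_mult_def complex_norm_square mult.commute
      del: of_real_power)

lemma adj_self_eq_0:
  assumes "adj A ** A = 0" shows "A = 0"
proof -
  have "(\<Sum>i\<in>UNIV. \<Sum>k\<in>UNIV. (cmod (A $ k $ i))\<^sup>2) = 0"
  proof -
    have "trace (adj A ** A) = 0" by (simp add: assms trace_def)
    then show ?thesis unfolding trace_adj_self by (simp only: of_real_eq_0_iff)
  qed
  then show ?thesis
    by (simp add: sum_nonneg_eq_0_iff sum_nonneg vec_eq_iff)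
qed

lemma psd_sqrt_cubic:
  assumes herm: "adj A = A" and cub: "A ** A ** A = (s\<^sup>2) *\<^sub>R A" and s: "s \<ge> 0"
  shows "psd_sqrt (adj A ** A) = (1 / s) *\<^sub>R (A ** A)"
proof -
  let ?B = "(1 / s) *\<^sub>R (A ** A)"
  have hermA2: "adj (A ** A) = A ** A" by (simp add: adj_mult herm)
  have A4: "(A ** A) ** (A ** A) = (s\<^sup>2) *\<^sub>R (A ** A)"
    by (metis cub matrix_mul_assoc matrix_scaleR_left)
  have A0: "A ** A = 0" if "s = 0"
    by (rule adj_self_eq_0) (simp add: hermA2 A4 that)
  have B: "psd ?B"
    unfolding psd_def
  proof safe
    show "adj ?B = ?B" by (simp add: adj_scaleR hermA2)
    fix v
    have "(?B *v v) = (1 / s) *\<^sub>R (A *v (A *v v))"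
      unfolding matrix_vector_mul_assoc
      by (simp add: vec_eq_iff matrix_vector_mult_def scaleR_sum_right)
    then have "cinner v (?B *v v) = (1 / s) *\<^sub>R cinner v (A *v (A *v v))"
      by (simp add: cinner_def scaleR_sum_right)
    also have "cinner v (A *v (A *v v)) = cinner (A *v v) (A *v v)"
      using cinner_adj[of v A "A *v v"] herm by simp
    also have "\<dots> = of_real ((norm (A *v v))\<^sup>2)" by (rule cinner_self)
    finally show "0 \<le> Re (cinner v (?B *v v))" using s by simp
  qed
  have BB: "?B ** ?B = A ** A"
    using A0 A4 by (cases "s = 0")
      (auto simp: matrix_scaleR_left matrix_scaleR_right power2_eq_square)
  have uniq: "S = ?B" if S: "psd S" "S ** S = A ** A" for S
  proof (cases "s = 0")
    case True
    have "S = 0" by (rule adj_self_eq_0) (use S A0 True in \<open>auto simp: psd_def\<close>)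
    then show ?thesis using True by simp
  next
    case False
    have inj: "X = 0" if X: "S ** X = - (s *\<^sub>R X)" for X :: "complex^'a^'a"
    proof -
      have "X *v w = 0" for w
      proof -
        have "S *v (X *v w) = - (s *\<^sub>R (X *v w))"
          unfolding matrix_vector_mul_assoc X
          by (simp add: vec_eq_iff matrix_vector_mult_def scaleR_sum_right sum_negf)
        then have "cinner (X *v w) (S *v (X *v w)) = - (s *\<^sub>R cinner (X *v w) (X *v w))"
          by (simp add: cinner_def scaleR_sum_right sum_negf)
        then have "Re (cinner (X *v w) (S *v (X *v w))) = - s * (norm (X *v w))\<^sup>2"
          by (simp add: cinner_self del: of_real_power)
        moreover have "0 \<le> Re (cinner (X *v w) (S *v (X *v w)))" using S(1) by (simp add: psd_def)
        ultimately have "s * (norm (X *v w))\<^sup>2 \<le> 0" by simp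
        then show ?thesis using False s by (simp add: mult_le_0_iff)
      qed
      then show ?thesis by (simp add: matrix_eq)
    qed
    define T where "T = S ** S - s *\<^sub>R S"
    have hT: "adj T = T" using S(1) by (simp add: T_def adj_diff adj_mult adj_scaleR psd_def)
    have S4: "S ** (S ** (S ** S)) = (s * s) *\<^sub>R (S ** S)"
      using A4 S(2) by (simp add: matrix_mul_assoc power2_eq_square)
    have "S ** (S ** T) = - (s *\<^sub>R (S ** T))"
      by (simp add: T_def matrix_diff_ldistrib matrix_scaleR_right S4 scaleR_diff_right)
    then have ST: "S ** T = 0" by (rule inj)
    have "T ** T = S ** (S ** T) - s *\<^sub>R (S ** T)"
      by (subst T_def) (simp add: matrix_diff_rdistrib matrix_scaleR_left matrix_mul_assoc)
    then have "adj T ** T = 0" using ST hT by simp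
    then have "T = 0" by (rule adj_self_eq_0)
    then have "A ** A = s *\<^sub>R S" using S(2) by (simp add: T_def)
    then show ?thesis using False by simp
  qed
  show ?thesis
    unfolding psd_sqrt_def herm
    by (rule the_equality) (use B BB uniq in blast)+
qed

lemma trace_norm_pure:
  assumes u: "norm u = 1" and v: "norm v = 1"
  shows "trace_norm (outer u u - outer v v) / 2 = sqrt (1 - (cmod (cinner u v))\<^sup>2)"
    and "(cmod (cinner u v))\<^sup>2 \<le> 1"
    and "(norm (outer u u - outer v v))\<^sup>2 = 2 * (1 - (cmod (cinner u v))\<^sup>2)"
proof -
  let ?P = "outer u u" and ?Q = "outer v v"
  let ?A = "?P - ?Q"
  let ?c = "cinner u v"
  let ?k = "(cmod ?c)\<^sup>2"
  have uu: "cinner u u = 1" and vv: "cinner v v = 1" using u v by (simp_all add: cinner_self)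
  have c': "cinner v u = cnj ?c" by (rule cinner_commute)
  have cc: "?c * cnj ?c = of_real ?k" by (rule complex_norm_square[symmetric])
  have PP: "?P ** ?P = ?P" and QQ: "?Q ** ?Q = ?Q"
    by (simp_all add: outer_mult uu vv)
  have PQP: "?P ** ?Q ** ?P = ?k *\<^sub>R ?P" and QPQ: "?Q ** ?P ** ?Q = ?k *\<^sub>R ?Q"
    by (simp_all add: outer_mult vector_smult_assoc c' cc mult.commute[of "cnj ?c"]
        outer_smult_of_real del: of_real_power)
  have herm: "adj ?A = ?A" by (simp add: adj_diff adj_outer)
  have A2: "?A ** ?A = ?P + ?Q - ?P ** ?Q - ?Q ** ?P"
    by (simp add: matrix_diff_ldistrib matrix_diff_rdistrib PP QQ)
  have trA2: "trace (?A ** ?A) = of_real (2 * (1 - ?k))"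
  proof -
    have "trace (?P ** ?Q) = of_real ?k"
      unfolding cc[symmetric] by (simp add: outer_mult trace_outer cinner_smult c')
    then show ?thesis
      unfolding A2 trace_diff trace_add
      by (subst (2) trace_mul_sym) (simp add: trace_outer uu vv)
  qed
  have fro: "(norm ?A)\<^sup>2 = 2 * (1 - ?k)"
  proof -
    have "(norm ?A)\<^sup>2 = (\<Sum>k\<in>UNIV. \<Sum>i\<in>UNIV. (cmod (?A $ k $ i))\<^sup>2)"
      by (simp add: norm_vec_def L2_set_def sum_nonneg)
    also have "\<dots> = (\<Sum>i\<in>UNIV. \<Sum>k\<in>UNIV. (cmod (?A $ k $ i))\<^sup>2)" by (rule sum.swap)
    finally have "of_real ((norm ?A)\<^sup>2) = trace (?A ** ?A)"
      using trace_adj_self[of ?A] herm by simp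
    then show ?thesis unfolding trA2 by (simp only: of_real_eq_iff)
  qed
  have k1: "?k \<le> 1" 
  proof -
    have "0 \<le> 2 * (1 - ?k)" unfolding fro[symmetric] by simp
    then show ?thesis by simp
  qed
  define s where "s = sqrt (1 - ?k)"
  have s: "s \<ge> 0" "s\<^sup>2 = 1 - ?k" using k1 by (simp_all add: s_def)
  have PQQ: "?P ** ?Q ** ?Q = ?P ** ?Q" and QPP: "?Q ** ?P ** ?P = ?Q ** ?P"
    by (simp_all add: matrix_mul_assoc[symmetric] PP QQ)
  have cub: "?A ** ?A ** ?A = s\<^sup>2 *\<^sub>R ?A"
    unfolding A2 s(2)
    by (simp add: matrix_diff_ldistrib matrix_diff_rdistrib matrix_plus_rdistrib PP QQ PQP QPQ PQQ QPP
        scaleR_diff_left scaleR_diff_right)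
  have "trace_norm ?A = (1 / s) * (2 * s\<^sup>2)"
    unfolding trace_norm_def psd_sqrt_cubic[OF herm cub s(1)] trace_scaleR trA2 s(2) by simp
  also have "\<dots> = 2 * s" by (simp add: power2_eq_square)
  finally show "trace_norm ?A / 2 = sqrt (1 - ?k)" by (simp add: s_def)
  show "?k \<le> 1" "(norm ?A)\<^sup>2 = 2 * (1 - ?k)" by fact+
qed

lemma density_inject: "density x = density y \<longleftrightarrow> x = y"
proof
  assume eq: "density x = density y"
  let ?u = "unit_rep x" and ?v = "unit_rep y"
  have out: "outer w w *v z = cinner w z *s w" for w z :: "complex^'a"
    by (simp add: vec_eq_iff outer_def matrix_vector_mult_def cinner_def sum_distrib_left
        sum_distrib_right mult_ac)
  have "cinner ?u ?u *s ?u = cinner ?v ?u *s ?v"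
    using eq out unfolding density_def by metis
  then have *: "?u = cinner ?v ?u *s ?v" by (simp add: cinner_self unit_rep(1))
  have "?u \<noteq> 0" "?v \<noteq> 0" using unit_rep(1)[of x] unit_rep(1)[of y] by auto
  then have "ray_of ?v = ray_of ?u"
    by (intro Quotient_rel_abs[OF Quotient_ray]) (use * in blast)
  then show "x = y" by (simp add: unit_rep(2))
qed simp

lemma trace_norm_density:
  "trace_norm (density x - density y) / 2 = norm (density x - density y) / sqrt 2"
proof -
  note t = trace_norm_pure[OF unit_rep(1)[of x] unit_rep(1)[of y], folded density_def]
  have "norm (density x - density y) = sqrt (2 * (1 - (cmod (cinner (unit_rep x) (unit_rep y)))\<^sup>2))"
    using t(3) by (metis norm_ge_zero real_sqrt_abs2 real_sqrt_unique power2_eq_square)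
  then show ?thesis unfolding t(1) by (simp only: real_sqrt_mult) simp
qed

instantiation ray :: (finite) metric_space
begin

definition dist_ray :: "'a ray \<Rightarrow> 'a ray \<Rightarrow> real" where
  "dist_ray x y = trace_norm (density x - density y) / 2"

definition uniformity_ray :: "('a ray \<times> 'a ray) filter" where
  "uniformity_ray = (INF e\<in>{0 <..}. principal {(x, y). dist x y < e})"

definition open_ray :: "'a ray set \<Rightarrow> bool" where
  "open_ray U \<longleftrightarrow> (\<forall>x\<in>U. eventually (\<lambda>(x', y). x' = x \<longrightarrow> y \<in> U) uniformity)"

instance
proof
  fix x y z :: "'a ray"
  show "dist x y = 0 \<longleftrightarrow> x = y"
    by (simp add: dist_ray_def trace_norm_density density_inject)
  have "norm (density x - density y) \<le> norm (density x - density z) + norm (density y - density z)"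
    using dist_triangle2[of "density x" "density y" "density z"] by (simp add: dist_norm)
  then show "dist x y \<le> dist x z + dist y z"
    unfolding dist_ray_def trace_norm_density
    by (simp add: add_divide_distrib[symmetric] divide_right_mono)
qed (fact uniformity_ray_def open_ray_def)+

end

lemma dist_ray_eq: "dist x y = sqrt (1 - (cmod (cinner (unit_rep x) (unit_rep y)))\<^sup>2)"
  by (simp add: dist_ray_def density_def trace_norm_pure(1) unit_rep(1))


section \<open>Wasserstein-1 distance\<close>

definition couplings :: "'a::topological_space measure \<Rightarrow> 'a measure \<Rightarrow> ('a \<times> 'a) measure set" where
  "couplings \<mu> \<nu> = {\<gamma> \<in> space (prob_algebra (borel \<Otimes>\<^sub>M borel)).
     distr \<gamma> borel fst = \<mu> \<and> distr \<gamma> borel snd = \<nu>}"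

definition W1 :: "'a::metric_space measure \<Rightarrow> 'a measure \<Rightarrow> ennreal" where
  "W1 \<mu> \<nu> = (INF \<gamma>\<in>couplings \<mu> \<nu>. \<integral>\<^sup>+ z. ennreal (dist (fst z) (snd z)) \<partial>\<gamma>)"


section \<open>Qudits\<close>

text \<open>The local dimension is \<open>d = CARD('d)\<close>, a prime by the sort of \<open>'d\<close>, and \<open>'d mod_ring\<close> is
  \<open>\<bbbF>\<^sub>d\<close>. The \<open>N = CARD('n)\<close> sites are labelled by a finite linear order, and the computational
  basis of \<open>(\<complex>\<^sup>d)\<^sup>\<otimes>\<^sup>N\<close> by the configurations \<open>'n \<Rightarrow> 'd mod_ring\<close>. The entry \<open>A $ j $ k\<close> is
  \<open>\<langle>j|A|k\<rangle>\<close>.\<close>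

type_synonym 'd qudit_op = "complex^'d mod_ring^'d mod_ring"
type_synonym ('n, 'd) op = "complex^('n \<Rightarrow> 'd mod_ring)^('n \<Rightarrow> 'd mod_ring)"
type_synonym ('n, 'd) state = "('n \<Rightarrow> 'd mod_ring) ray"

definition tensor_op :: "('n::finite \<Rightarrow> 'd::finite qudit_op) \<Rightarrow> ('n, 'd) op" where
  "tensor_op A = (\<chi> s t. \<Prod>j\<in>UNIV. A j $ s j $ t j)"

definition on_first :: "'d::finite qudit_op \<Rightarrow> ('n::{finite,linorder}, 'd) op" where
  "on_first A = tensor_op (\<lambda>j. if j = Min UNIV then A else mat 1)"

definition rep :: "'d::finite mod_ring \<Rightarrow> nat" where
  "rep x = nat (to_int_mod_ring x)"

definition omega :: "'d::finite itself \<Rightarrow> complex" where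
  "omega _ = exp (2 * pi * \<i> / CARD('d))"

definition X_op :: "'d::prime_card qudit_op" where
  "X_op = (\<chi> j k. if j = k + 1 then 1 else 0)"

definition Z_op :: "'d::prime_card qudit_op" where
  "Z_op = (\<chi> j k. if j = k then omega TYPE('d) ^ rep k else 0)"

definition pauli_op :: "('n::finite \<Rightarrow> 'd::prime_card mod_ring) \<Rightarrow> ('n \<Rightarrow> 'd mod_ring) \<Rightarrow> ('n, 'd) op" where
  "pauli_op q p = tensor_op (\<lambda>j. matpow Z_op (rep (p j)) ** matpow X_op (rep (q j)))"


section \<open>The projective Pauli and Clifford groups\<close>

definition unitary_group :: "(complex^'i::finite^'i) monoid" where
  "unitary_group = \<lparr>carrier = {U. adj U ** U = mat 1 \<and> U ** adj U = mat 1}, mult = (**), one = mat 1\<rparr>"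

definition phases :: "(complex^'i::finite^'i) set" where
  "phases = {mat c | c. cmod c = 1}"

definition PU :: "(complex^'i::finite^'i) set monoid" where
  "PU = unitary_group Mod phases"

definition proj_class :: "complex^'i::finite^'i \<Rightarrow> (complex^'i^'i) set" where
  "proj_class U = phases #>\<^bsub>unitary_group\<^esub> U"

definition pauli_group :: "('n::finite, 'd::prime_card) op set set" where
  "pauli_group = {proj_class (pauli_op q p) | q p. True}"

definition clifford_group :: "('n::finite, 'd::prime_card) op set set" where
  "clifford_group = normalizer PU pauli_group"

definition unitary_rep :: "(complex^'i::finite^'i) set \<Rightarrow> complex^'i^'i" where
  "unitary_rep K = (SOME U. U \<in> K)"


section \<open>The monitored circuit\<close>

definition F_op :: "'d::prime_card qudit_op" where
  "F_op = (\<chi> j k. omega TYPE('d) ^ rep (j * k) / sqrt (CARD('d)))"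

definition rot_entry :: "real \<Rightarrow> 'd::prime_card mod_ring \<Rightarrow> 'd mod_ring \<Rightarrow> complex" where
  "rot_entry \<theta> a k =
    (if CARD('d) = 2 then (if k = 0 then 1 else exp (\<i> * \<theta> * pi / 4))
     else if CARD('d) = 3 then
       (if k = 0 then 1 else if k = 1 then exp (2 * pi * \<i> * \<theta> / 9) else exp (- 2 * pi * \<i> * \<theta> / 9))
     else exp (- 2 * pi * \<i> * \<theta> * rep (a * k ^ 3) / CARD('d)))"

definition D_op :: "real \<Rightarrow> 'd::prime_card mod_ring \<Rightarrow> 'd qudit_op" where
  "D_op \<theta> a = (\<chi> j k. if j = k then rot_entry \<theta> a k else 0)"

definition R_op :: "real \<Rightarrow> 'd::prime_card mod_ring \<Rightarrow> 'd qudit_op" where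
  "R_op \<theta> a = adj F_op ** D_op \<theta> a ** F_op"

definition Pi_op :: "'d::prime_card mod_ring \<Rightarrow> ('n::{finite,linorder}, 'd) op" where
  "Pi_op m = on_first (\<chi> j k. if j = m \<and> k = m then 1 else 0)"

text \<open>A branch is a pair of a projective Clifford element (a class of unitaries modulo phases) and
  an outcome. The formulas below do not depend on the representatives chosen.\<close>

type_synonym ('n, 'd) branch = "('n, 'd) op set \<times> 'd mod_ring"

definition branches :: "('n::finite, 'd::prime_card) branch set" where
  "branches = clifford_group \<times> UNIV"

definition outcome_vec ::
  "real \<Rightarrow> 'd::prime_card mod_ring \<Rightarrow> ('n::{finite,linorder}, 'd) branch \<Rightarrow> ('n, 'd) state
    \<Rightarrow> complex^('n \<Rightarrow> 'd mod_ring)" where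
  "outcome_vec \<theta> a J \<psi> =
    (Pi_op (snd J) ** on_first (R_op \<theta> a) ** unitary_rep (fst J)) *v unit_rep \<psi>"

definition branch_prob ::
  "real \<Rightarrow> 'd::prime_card mod_ring \<Rightarrow> ('n::{finite,linorder}, 'd) branch \<Rightarrow> ('n, 'd) state \<Rightarrow> real" where
  "branch_prob \<theta> a J \<psi> = (norm (outcome_vec \<theta> a J \<psi>))\<^sup>2"

definition branch_map ::
  "real \<Rightarrow> 'd::prime_card mod_ring \<Rightarrow> ('n::{finite,linorder}, 'd) branch \<Rightarrow> ('n, 'd) state
    \<Rightarrow> ('n, 'd) state" where
  "branch_map \<theta> a J \<psi> = ray_of (adj (unitary_rep (fst J)) *v outcome_vec \<theta> a J \<psi>)"

definition kernel_value ::
  "real \<Rightarrow> 'd::prime_card mod_ring \<Rightarrow> ('n::{finite,linorder}, 'd) state \<Rightarrow> ('n, 'd) state set \<Rightarrow> real" where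
  "kernel_value \<theta> a \<psi> A =
    (\<Sum>J\<in>{J \<in> branches. branch_prob \<theta> a J \<psi> > 0}.
       branch_prob \<theta> a J \<psi> * indicator A (branch_map \<theta> a J \<psi>))
    / card (clifford_group :: ('n, 'd) op set set)"

definition circuit_kernel ::
  "real \<Rightarrow> 'd::prime_card mod_ring \<Rightarrow> ('n::{finite,linorder}, 'd) state \<Rightarrow> ('n, 'd) state measure" where
  "circuit_kernel \<theta> a \<psi> = measure_of UNIV (sets borel) (\<lambda>A. ennreal (kernel_value \<theta> a \<psi> A))"

definition circuit_step ::
  "real \<Rightarrow> 'd::prime_card mod_ring \<Rightarrow> ('n::{finite,linorder}, 'd) state measure
    \<Rightarrow> ('n, 'd) state measure" where
  "circuit_step \<theta> a \<mu> = Giry_Monad.bind \<mu> (circuit_kernel \<theta> a)"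

end

(* The kernel satisfies a Doeblin condition. Conjugating by a swap of sites and, optionally, by F on
   every site, products of N branch operators U^dag Pi_m R U reach the rank-one operators
   |m><m| R^(x)N and |e><0|(R F)^(x)N, where e is proportional to (F^dag |0>)^(x)N. Whatever the state,
   some outcome string m of the first round has probability at least 1/D (given the swaps), and no
   entry of R F = F^dag D F^2 vanishes, because F^2 is the parity; so the second round leads from |m>
   to the ray of e. Hence after 2N steps this ray has mass at least a constant, uniformly in the
   initial state. The finiteness of the Clifford group, needed for the kernel to be one, comes from
   its action on Pauli operators. *)

theory Submission
  imports Defs
begin

section \<open>Geometric ergodicity from a uniform atom\<close>

text \<open>The two rounds have to differ. At \<open>\<theta> = 0\<close> the rotation
  \<open>R_op\<close> is the identity, so rounds of the first kind alone only measure in the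
  computational basis, and distinct basis states never merge. Conjugation by the Fourier operator
  replaces a row of \<open>R_op\<close> by a row of \<open>R_op ** F_op\<close>; since no entry of
  it vanishes, each basis state passes to the same ray with positive probability, and a minimum over
  the finitely many basis states makes this uniform. The common atom takes the place of compactness
  and continuity: branch maps are undefined where their probability vanishes, so the kernel is only
  shown to be measurable. After each block of 2N steps a fixed fraction of the mass has forgotten
  the initial law. Hence two laws differ only in a part of geometrically decaying weight, and
  existence, uniqueness and convergence all come from this splitting. Because distances are at most
  1, the weight of the unmatched part also bounds \<open>W1\<close>.\<close>

definition mixture :: "real \<Rightarrow> 'a measure \<Rightarrow> 'a measure \<Rightarrow> 'a measure" where
  "mixture r \<mu> \<nu> = measure_pmf (bernoulli_pmf r) \<bind> (\<lambda>b. if b then \<mu> else \<nu>)"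

lemma measure_pmf_in_prob_algebra: "measure_pmf p \<in> space (prob_algebra (count_space UNIV))"
  by (simp add: space_prob_algebra measure_pmf.prob_space_axioms)

lemma bind_in_prob_algebra:
  assumes "\<mu> \<in> space (prob_algebra M)" "K \<in> M \<rightarrow>\<^sub>M prob_algebra L"
  shows "\<mu> \<bind> K \<in> space (prob_algebra L)"
  using prob_space_bind'[OF assms] sets_bind'[OF assms] by (simp add: space_prob_algebra)

lemma bind_assoc_prob_algebra:
  assumes "\<mu> \<in> space (prob_algebra M)" "K \<in> M \<rightarrow>\<^sub>M prob_algebra L" "K' \<in> L \<rightarrow>\<^sub>M prob_algebra R"
  shows "(\<mu> \<bind> K) \<bind> K' = \<mu> \<bind> (\<lambda>x. K x \<bind> K')"
proof (rule bind_assoc[of K \<mu> L K' R])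
  show "K \<in> \<mu> \<rightarrow>\<^sub>M subprob_algebra L"
    using assms(1) measurable_prob_algebraD[OF assms(2)]
    by (simp add: space_prob_algebra cong: measurable_cong_sets)
qed (rule measurable_prob_algebraD[OF assms(3)])

context
  fixes M :: "'a measure" and \<mu> \<nu> :: "'a measure"
  assumes \<mu>: "\<mu> \<in> space (prob_algebra M)" and \<nu>: "\<nu> \<in> space (prob_algebra M)"
begin

lemma mixture_in_prob_algebra: "mixture r \<mu> \<nu> \<in> space (prob_algebra M)"
  unfolding mixture_def
  by (rule bind_in_prob_algebra[OF measure_pmf_in_prob_algebra]) (use \<mu> \<nu> in auto)

lemma nn_integral_mixture:
  assumes "0 \<le> r" "r \<le> 1" "f \<in> borel_measurable M"
  shows "(\<integral>\<^sup>+ x. f x \<partial>mixture r \<mu> \<nu>) = ennreal r * (\<integral>\<^sup>+ x. f x \<partial>\<mu>) + ennreal (1 - r) * (\<integral>\<^sup>+ x. f x \<partial>\<nu>)"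
  unfolding mixture_def
  using assms \<mu> \<nu>
  by (subst nn_integral_bind[where B=M])
     (auto simp: space_prob_algebra space_subprob_algebra prob_space_imp_subprob_space
        nn_integral_measure_pmf nn_integral_count_space_finite UNIV_bool mult.commute
        simp flip: ennreal_mult'')

lemma emeasure_mixture:
  assumes "0 \<le> r" "r \<le> 1" "A \<in> sets M"
  shows "emeasure (mixture r \<mu> \<nu>) A = ennreal r * emeasure \<mu> A + ennreal (1 - r) * emeasure \<nu> A"
proof -
  have s: "sets \<mu> = sets M" "sets \<nu> = sets M" "sets (mixture r \<mu> \<nu>) = sets M"
    using \<mu> \<nu> mixture_in_prob_algebra[of r] by (auto simp: space_prob_algebra)
  show ?thesis
    using nn_integral_mixture[OF assms(1,2), of "indicator A"] assms(3) s by simp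
qed

lemma measure_mixture:
  assumes "0 \<le> r" "r \<le> 1" "A \<in> sets M"
  shows "measure (mixture r \<mu> \<nu>) A = r * measure \<mu> A + (1 - r) * measure \<nu> A"
proof -
  have "prob_space \<mu>" "prob_space \<nu>" "prob_space (mixture r \<mu> \<nu>)"
    using \<mu> \<nu> mixture_in_prob_algebra[of r] by (auto simp: space_prob_algebra)
  then interpret a: prob_space \<mu> + b: prob_space \<nu> + c: prob_space "mixture r \<mu> \<nu>" by simp_all
  show ?thesis
    using emeasure_mixture[OF assms] assms
    by (simp add: a.emeasure_eq_measure b.emeasure_eq_measure c.emeasure_eq_measure
        flip: ennreal_mult ennreal_plus)
qed

text \<open>A mixture is itself a bind over a Bernoulli choice, so linearity of the action of a
  kernel is an instance of associativity of bind.\<close>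

lemma bind_mixture:
  assumes "K \<in> M \<rightarrow>\<^sub>M prob_algebra L"
  shows "mixture r \<mu> \<nu> \<bind> K = mixture r (\<mu> \<bind> K) (\<nu> \<bind> K)"
  unfolding mixture_def
  by (subst bind_assoc_prob_algebra[OF measure_pmf_in_prob_algebra _ assms])
     (use \<mu> \<nu> in \<open>auto intro!: bind_cong\<close>)

end

lemma prob_measure_eqI:
  assumes "\<mu> \<in> space (prob_algebra M)" "\<nu> \<in> space (prob_algebra M)"
    "\<And>A. A \<in> sets M \<Longrightarrow> measure \<mu> A = measure \<nu> A"
  shows "\<mu> = \<nu>"
proof (rule measure_eqI)
  show "sets \<mu> = sets \<nu>" using assms by (simp add: space_prob_algebra)
  fix A assume "A \<in> sets \<mu>"
  then have "measure \<mu> A = measure \<nu> A" using assms by (simp add: space_prob_algebra)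
  then show "emeasure \<mu> A = emeasure \<nu> A"
    using assms(1,2)
    by (simp add: space_prob_algebra finite_measure.emeasure_eq_measure prob_space.finite_measure)
qed

text \<open>Reassociates a three-term convex combination: \<mu> keeps its total weight r * s, and
  the rest is renormalised by 1 - r * s, which has to be positive. This lets mass that has just been
  refreshed be absorbed into a component shared by all initial laws.\<close>

lemma mixture_mixture:
  assumes "\<mu> \<in> space (prob_algebra M)" "\<nu> \<in> space (prob_algebra M)" "\<kappa> \<in> space (prob_algebra M)"
    and r: "0 \<le> r" "r \<le> 1" "0 \<le> s" "s \<le> 1" and rs: "r * s < 1"
  shows "mixture r (mixture s \<mu> \<nu>) \<kappa>
    = mixture (r * s) \<mu> (mixture (r * (1 - s) / (1 - r * s)) \<nu> \<kappa>)"
proof -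
  define t where "t = r * (1 - s) / (1 - r * s)"
  note [simp] = assms(1-3) mixture_in_prob_algebra
  have rs01: "0 \<le> r * s" "r * s \<le> 1" using r rs by auto
  have "r * (1 - s) \<le> 1 - r * s" using r by (simp add: algebra_simps)
  then have t: "0 \<le> t" "t \<le> 1" using r rs by (auto simp: t_def divide_simps)
  have "mixture r (mixture s \<mu> \<nu>) \<kappa> = mixture (r * s) \<mu> (mixture t \<nu> \<kappa>)"
  proof (rule prob_measure_eqI)
    fix A assume A: "A \<in> sets M"
    have e: "(1 - r * s) * t = r * (1 - s)" "(1 - r * s) * (1 - t) = 1 - r"
      using rs by (auto simp: t_def field_simps)
    have "measure (mixture (r * s) \<mu> (mixture t \<nu> \<kappa>)) A
      = r * s * measure \<mu> A + ((1 - r * s) * t) * measure \<nu> A + ((1 - r * s) * (1 - t)) * measure \<kappa> A"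
      by (simp add: measure_mixture[where M=M] A r rs01 t algebra_simps)
    then show "measure (mixture r (mixture s \<mu> \<nu>) \<kappa>) A = measure (mixture (r * s) \<mu> (mixture t \<nu> \<kappa>)) A"
      unfolding e by (simp add: measure_mixture[where M=M] A r rs01 t algebra_simps)
  qed simp_all
  then show ?thesis by (simp only: t_def)
qed

text \<open>Removes the atom \<open>\<epsilon> \<delta>\<^sub>u\<close> from \<open>\<mu>\<close> and renormalises.\<close>

definition residual :: "real \<Rightarrow> 'a \<Rightarrow> 'a measure \<Rightarrow> 'a measure" where
  "residual \<epsilon> u \<mu> = Nonnegative_Lebesgue_Integration.density \<mu>
    (\<lambda>x. ennreal (if x = u then (measure \<mu> {u} - \<epsilon>) / ((1 - \<epsilon>) * measure \<mu> {u}) else 1 / (1 - \<epsilon>)))"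

context
  fixes M :: "'a measure" and \<epsilon> :: real and u :: 'a
  assumes u: "{u} \<in> sets M" and \<epsilon>: "0 < \<epsilon>" "\<epsilon> < 1"
begin

text \<open>The density takes one value at u and another elsewhere, chosen so that the result is
  (\<mu> - \<epsilon> \<delta>_u) / (1 - \<epsilon>). This closed form makes both the total mass and
  the measurability in a parameter easy to read off.\<close>

lemma emeasure_residual:
  assumes \<mu>: "\<mu> \<in> space (prob_algebra M)" and atom: "\<epsilon> \<le> measure \<mu> {u}" and A: "A \<in> sets M"
  shows "emeasure (residual \<epsilon> u \<mu>) A = ennreal ((measure \<mu> A - \<epsilon> * indicator A u) / (1 - \<epsilon>))"
proof -
  interpret prob_space \<mu> using \<mu> by (simp add: space_prob_algebra)
  have s[simp, measurable_cong]: "sets \<mu> = sets M" using \<mu> by (simp add: space_prob_algebra)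
  let ?m = "measure \<mu> {u}"
  let ?a = "(?m - \<epsilon>) / ((1 - \<epsilon>) * ?m)" and ?b = "1 / (1 - \<epsilon>)"
  have nn: "0 \<le> ?a" "0 \<le> ?b" "0 < ?m" using \<epsilon> atom by auto
  have m1: "?m \<le> 1" by simp
  have [measurable]: "{u} \<in> sets M" "A \<in> sets M" using u A .
  have d: "A - {u} \<in> sets M" using A u by blast
  have "(\<lambda>x. ennreal (if x \<in> {u} then ?a else ?b)) \<in> borel_measurable \<mu>"
    by measurable
  have "emeasure (residual \<epsilon> u \<mu>) A
    = (\<integral>\<^sup>+ x. ennreal (?a * indicator A u) * indicator {u} x + ennreal ?b * indicator (A - {u}) x \<partial>\<mu>)"
    unfolding residual_def using A \<open>_ \<in> borel_measurable \<mu>\<close>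
    by (subst emeasure_density) (auto intro!: nn_integral_cong split: split_indicator)
  also have "\<dots> = ennreal (?a * indicator A u) * ennreal ?m + ennreal ?b * ennreal (measure \<mu> (A - {u}))"
    using u d by (subst nn_integral_add) (auto simp: nn_integral_cmult_indicator emeasure_eq_measure)
  also have "\<dots> = ennreal (?a * indicator A u * ?m + ?b * measure \<mu> (A - {u}))"
  proof -
    have "0 \<le> ?a * indicator A u" using nn by (simp split: split_indicator)
    then show ?thesis
      by (simp only: ennreal_mult ennreal_plus mult_nonneg_nonneg measure_nonneg nn)
  qed
  also have "?a * indicator A u * ?m + ?b * measure \<mu> (A - {u}) = (measure \<mu> A - \<epsilon> * indicator A u) / (1 - \<epsilon>)"
  proof (cases "u \<in> A")
    case True
    then have "measure \<mu> (A - {u}) = measure \<mu> A - ?m"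
      using A u by (subst finite_measure_Diff) auto
    moreover have "?a * ?m = (?m - \<epsilon>) / (1 - \<epsilon>)" using nn(3) by simp
    ultimately show ?thesis using True by (simp add: diff_divide_distrib)
  qed simp
  finally show ?thesis .
qed

lemma atom_le_measure:
  assumes \<mu>: "\<mu> \<in> space (prob_algebra M)" and atom: "\<epsilon> \<le> measure \<mu> {u}" and A: "A \<in> sets M"
  shows "\<epsilon> * indicator A u \<le> measure \<mu> A"
proof -
  interpret prob_space \<mu> using \<mu> by (simp add: space_prob_algebra)
  have "u \<in> A \<Longrightarrow> measure \<mu> {u} \<le> measure \<mu> A"
    using \<mu> A u by (intro finite_measure_mono) (auto simp: space_prob_algebra)
  then show ?thesis using atom by (auto split: split_indicator)
qed

lemma residual_in_prob_algebra:
  assumes \<mu>: "\<mu> \<in> space (prob_algebra M)" and atom: "\<epsilon> \<le> measure \<mu> {u}"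
  shows "residual \<epsilon> u \<mu> \<in> space (prob_algebra M)"
proof -
  interpret prob_space \<mu> using \<mu> by (simp add: space_prob_algebra)
  have s: "sets \<mu> = sets M" using \<mu> by (simp add: space_prob_algebra)
  then have sp: "space \<mu> = space M" by (rule sets_eq_imp_space_eq)
  have "u \<in> space M" using sets.sets_into_space[OF u] by auto
  then have "emeasure (residual \<epsilon> u \<mu>) (space M) = 1"
    using \<epsilon> prob_space by (subst emeasure_residual[OF assms]) (auto simp: sp)
  then show ?thesis
    by (auto simp: space_prob_algebra residual_def s sp intro!: prob_spaceI)
qed

text \<open>The Doeblin splitting of a single law: with probability \<epsilon> restart at u,
  otherwise draw from the residual law.\<close>

lemma residual_decomposition:
  assumes \<mu>: "\<mu> \<in> space (prob_algebra M)" and atom: "\<epsilon> \<le> measure \<mu> {u}"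
  shows "\<mu> = mixture (1 - \<epsilon>) (residual \<epsilon> u \<mu>) (return M u)"
proof (rule prob_measure_eqI[OF \<mu>])
  have uM: "u \<in> space M" using sets.sets_into_space[OF u] by auto
  then have ret: "return M u \<in> space (prob_algebra M)"
    by (simp add: space_prob_algebra prob_space_return)
  note res = residual_in_prob_algebra[OF assms]
  show "mixture (1 - \<epsilon>) (residual \<epsilon> u \<mu>) (return M u) \<in> space (prob_algebra M)"
    by (rule mixture_in_prob_algebra[OF res ret])
  fix A assume A: "A \<in> sets M"
  have "measure (residual \<epsilon> u \<mu>) A = (measure \<mu> A - \<epsilon> * indicator A u) / (1 - \<epsilon>)"
    unfolding measure_def[of "residual \<epsilon> u \<mu>"] emeasure_residual[OF assms A]
    using \<epsilon> atom_le_measure[OF assms A] by simp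
  moreover have "measure (return M u) A = indicator A u"
    using A by (simp add: measure_return)
  ultimately show "measure \<mu> A = measure (mixture (1 - \<epsilon>) (residual \<epsilon> u \<mu>) (return M u)) A"
    using \<epsilon> by (subst measure_mixture[OF res ret]) (auto simp: A field_simps)
qed

text \<open>By the closed form, the residual of K x on A depends on x only through
  \<open>measure (K x) A\<close>.\<close>

lemma measurable_residual:
  assumes K: "K \<in> N \<rightarrow>\<^sub>M prob_algebra M" and atom: "\<And>x. x \<in> space N \<Longrightarrow> \<epsilon> \<le> measure (K x) {u}"
  shows "(\<lambda>x. residual \<epsilon> u (K x)) \<in> N \<rightarrow>\<^sub>M prob_algebra M"
proof (rule measurable_prob_algebraI)
  have Kx: "K x \<in> space (prob_algebra M)" if "x \<in> space N" for x
    using measurable_space[OF K that] .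
  have r: "residual \<epsilon> u (K x) \<in> space (prob_algebra M)" if "x \<in> space N" for x
    by (rule residual_in_prob_algebra[OF Kx atom]) (use that in auto)
  then show "prob_space (residual \<epsilon> u (K x))" if "x \<in> space N" for x
    using that by (simp add: space_prob_algebra)
  show "(\<lambda>x. residual \<epsilon> u (K x)) \<in> N \<rightarrow>\<^sub>M subprob_algebra M"
  proof (rule measurable_subprob_algebra)
    fix A assume A: "A \<in> sets M"
    have "(\<lambda>x. measure (K x) A) \<in> borel_measurable N"
      using measurable_compose[OF K measurable_measure_prob_algebra[OF A]] .
    then have "(\<lambda>x. ennreal ((measure (K x) A - \<epsilon> * indicator A u) / (1 - \<epsilon>))) \<in> borel_measurable N"
      by measurable
    then show "(\<lambda>x. emeasure (residual \<epsilon> u (K x)) A) \<in> borel_measurable N"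
      by (rule measurable_cong[THEN iffD1, rotated])
         (auto simp: emeasure_residual[OF Kx atom A])
  qed (use r in \<open>auto simp: space_prob_algebra prob_space_imp_subprob_space\<close>)
qed

end

text \<open>The invariant law is the law of \<open>S\<^sup>G u\<close>, where \<open>S\<close> is the residual kernel and \<open>G\<close> is
  geometric, so no limit of measures is needed.\<close>

lemma uniform_atom_ergodic:
  fixes M :: "'a measure"
  assumes K: "K \<in> M \<rightarrow>\<^sub>M prob_algebra M" and u: "{u} \<in> sets M" and \<epsilon>: "0 < \<epsilon>" "\<epsilon> < 1"
    and atom: "\<And>x. x \<in> space M \<Longrightarrow> \<epsilon> \<le> measure (K x) {u}"
  shows "\<exists>\<pi>\<in>space (prob_algebra M). \<pi> \<bind> K = \<pi>"
    and "\<exists>c\<in>space (prob_algebra M). \<forall>\<mu>\<in>space (prob_algebra M). \<exists>\<mu>'\<in>space (prob_algebra M).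
      ((\<lambda>\<nu>. \<nu> \<bind> K) ^^ k) \<mu> = mixture ((1 - \<epsilon>) ^ k) \<mu>' c"
proof -
  let ?P = "space (prob_algebra M)"
  let ?r = "1 - \<epsilon>"
  define Q where "Q = (\<lambda>x. residual \<epsilon> u (K x))"
  have Q: "Q \<in> M \<rightarrow>\<^sub>M prob_algebra M"
    unfolding Q_def by (rule measurable_residual[OF u \<epsilon> K atom])
  have uM: "u \<in> space M" using sets.sets_into_space[OF u] by auto
  then have ret: "return M u \<in> ?P"
    by (simp add: space_prob_algebra prob_space_return)
  have KQ: "K x = mixture ?r (Q x) (return M u)" if "x \<in> space M" for x
    unfolding Q_def by (rule residual_decomposition[OF u \<epsilon> measurable_space[OF K] atom]) (use that in auto)
  \<comment> \<open>The pointwise splitting integrated over \<mu>. The restart component is the same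
    for every \<mu>, which is the source of the forgetting.\<close>
  have T: "\<mu> \<bind> K = mixture ?r (\<mu> \<bind> Q) (return M u)" if \<mu>: "\<mu> \<in> ?P" for \<mu>
  proof (rule prob_measure_eqI)
    note \<mu>Q = bind_in_prob_algebra[OF \<mu> Q]
    show "\<mu> \<bind> K \<in> ?P" by (rule bind_in_prob_algebra[OF \<mu> K])
    show m: "mixture ?r (\<mu> \<bind> Q) (return M u) \<in> ?P" by (rule mixture_in_prob_algebra[OF \<mu>Q ret])
    interpret prob_space \<mu> using \<mu> by (simp add: space_prob_algebra)
    have s[simp, measurable_cong]: "sets \<mu> = sets M" using \<mu> by (simp add: space_prob_algebra)
    have sp: "space \<mu> = space M" using s by (rule sets_eq_imp_space_eq)
    fix A assume A: "A \<in> sets M"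
    have meas: "(\<lambda>x. emeasure (Q x) A) \<in> borel_measurable \<mu>"
      using measurable_compose[OF measurable_prob_algebraD[OF Q] measurable_emeasure_subprob_algebra[OF A]]
      by simp
    have "emeasure (\<mu> \<bind> K) A = (\<integral>\<^sup>+ x. emeasure (K x) A \<partial>\<mu>)"
      by (rule emeasure_bind_prob_algebra[OF \<mu> K A])
    also have "\<dots> = (\<integral>\<^sup>+ x. ennreal ?r * emeasure (Q x) A + ennreal (1 - ?r) * emeasure (return M u) A \<partial>\<mu>)"
      by (rule nn_integral_cong)
         (use \<epsilon> A emeasure_mixture[OF measurable_space[OF Q] ret, of _ ?r A] in \<open>simp add: sp KQ\<close>)
    also have "\<dots> = ennreal ?r * emeasure (\<mu> \<bind> Q) A + ennreal (1 - ?r) * emeasure (return M u) A"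
      using meas emeasure_space_1
      by (subst nn_integral_add) (auto simp: nn_integral_cmult emeasure_bind_prob_algebra[OF \<mu> Q A])
    also have "\<dots> = emeasure (mixture ?r (\<mu> \<bind> Q) (return M u)) A"
      by (rule emeasure_mixture[OF \<mu>Q ret, symmetric]) (use \<epsilon> A in auto)
    finally show "measure (\<mu> \<bind> K) A = measure (mixture ?r (\<mu> \<bind> Q) (return M u)) A"
      by (simp add: measure_def)
  qed
  define S where "S = (\<lambda>k. ((\<lambda>\<nu>. \<nu> \<bind> Q) ^^ k) (return M u))"
  have S: "S k \<in> ?P" for k
    unfolding S_def by (induction k) (auto intro: ret bind_in_prob_algebra[OF _ Q])
  have Sm: "S \<in> count_space UNIV \<rightarrow>\<^sub>M prob_algebra M" using S by auto
  define \<pi> where "\<pi> = measure_pmf (geometric_pmf \<epsilon>) \<bind> S"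
  have \<pi>: "\<pi> \<in> ?P" unfolding \<pi>_def by (rule bind_in_prob_algebra[OF measure_pmf_in_prob_algebra Sm])
  have "\<pi> \<bind> K = mixture ?r (\<pi> \<bind> Q) (return M u)" by (rule T[OF \<pi>])
  also have "\<dots> = \<pi>"
  proof (rule prob_measure_eqI[OF mixture_in_prob_algebra[OF bind_in_prob_algebra[OF \<pi> Q] ret] \<pi>])
    fix A assume A: "A \<in> sets M"
    have \<pi>Q: "\<pi> \<bind> Q = measure_pmf (geometric_pmf \<epsilon>) \<bind> (\<lambda>k. S (Suc k))"
      unfolding \<pi>_def by (subst bind_assoc_prob_algebra[OF measure_pmf_in_prob_algebra Sm Q]) (simp add: S_def)
    have e: "emeasure \<pi> A = (\<integral>\<^sup>+ k. ennreal (\<epsilon> * ?r ^ k) * emeasure (S k) A \<partial>count_space UNIV)"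
      unfolding \<pi>_def using \<epsilon>
      by (subst emeasure_bind_prob_algebra[OF measure_pmf_in_prob_algebra Sm A])
         (simp add: nn_integral_measure_pmf mult.commute)
    also have "\<dots> = (\<Sum>k. ennreal (\<epsilon> * ?r ^ k) * emeasure (S k) A)"
      by (rule nn_integral_count_space_nat)
    \<comment> \<open>\<pi> is the series of \<epsilon> (1 - \<epsilon>)^k S k. Its term k = 0 is
      the restart part \<epsilon> \<delta>_u; the remaining terms are 1 - \<epsilon> times the image
      of the series under Q, because Q maps S k to S (k + 1).\<close>
    also have "\<dots> = (\<Sum>k. ennreal (\<epsilon> * ?r ^ Suc k) * emeasure (S (Suc k)) A) + ennreal \<epsilon> * emeasure (S 0) A"
      by (subst suminf_offset[where i=1]) (auto simp: add.commute)
    also have "(\<Sum>k. ennreal (\<epsilon> * ?r ^ Suc k) * emeasure (S (Suc k)) A)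
        = (\<Sum>k. ennreal ?r * (ennreal (\<epsilon> * ?r ^ k) * emeasure (S (Suc k)) A))"
    proof -
      have "ennreal (\<epsilon> * ?r ^ Suc k) = ennreal ?r * ennreal (\<epsilon> * ?r ^ k)" for k
        using \<epsilon> by (simp add: ennreal_mult[symmetric] mult_ac)
      then show ?thesis by (simp only: mult.assoc)
    qed
    also have "\<dots> = ennreal ?r * (\<Sum>k. ennreal (\<epsilon> * ?r ^ k) * emeasure (S (Suc k)) A)"
      by simp
    also have "(\<Sum>k. ennreal (\<epsilon> * ?r ^ k) * emeasure (S (Suc k)) A) = emeasure (\<pi> \<bind> Q) A"
    proof -
      have "emeasure (\<pi> \<bind> Q) A = (\<integral>\<^sup>+ k. emeasure (S (Suc k)) A \<partial>geometric_pmf \<epsilon>)"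
        unfolding \<pi>Q by (rule emeasure_bind_prob_algebra[OF measure_pmf_in_prob_algebra _ A]) (use S in auto)
      also have "\<dots> = (\<integral>\<^sup>+ k. ennreal (\<epsilon> * ?r ^ k) * emeasure (S (Suc k)) A \<partial>count_space UNIV)"
        using \<epsilon> by (simp add: nn_integral_measure_pmf mult.commute)
      finally show ?thesis by (simp add: nn_integral_count_space_nat)
    qed
    also have "ennreal ?r * emeasure (\<pi> \<bind> Q) A + ennreal \<epsilon> * emeasure (S 0) A
        = emeasure (mixture ?r (\<pi> \<bind> Q) (return M u)) A"
      using \<epsilon> A by (subst emeasure_mixture[OF bind_in_prob_algebra[OF \<pi> Q] ret]) (auto simp: S_def)
    finally show "measure (mixture ?r (\<pi> \<bind> Q) (return M u)) A = measure \<pi> A"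
      by (simp add: measure_def)
  qed
  finally show "\<exists>\<pi>\<in>?P. \<pi> \<bind> K = \<pi>" using \<pi> by blast
  \<comment> \<open>The order of the quantifiers is the point: c is fixed before \<mu>, so any two
    initial laws share it.\<close>
  show "\<exists>c\<in>?P. \<forall>\<mu>\<in>?P. \<exists>\<mu>'\<in>?P. ((\<lambda>\<nu>. \<nu> \<bind> K) ^^ k) \<mu> = mixture (?r ^ k) \<mu>' c"
  proof (induction k)
    case 0
    \<comment> \<open>At k = 0 the shared component has weight 0, so any probability measure can
      serve as c.\<close>
    have "\<mu> = mixture 1 \<mu> (return M u)" if "\<mu> \<in> ?P" for \<mu>
      using measure_mixture[OF that ret, of 1]
      by (intro prob_measure_eqI[OF that mixture_in_prob_algebra[OF that ret]]) auto
    then show ?case using ret by auto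
  next
    case (Suc k)
    then obtain c where c: "c \<in> ?P"
      and cm: "\<And>\<mu>. \<mu> \<in> ?P \<Longrightarrow> \<exists>\<mu>'\<in>?P. ((\<lambda>\<nu>. \<nu> \<bind> K) ^^ k) \<mu> = mixture (?r ^ k) \<mu>' c" by blast
    \<comment> \<open>The new shared component consists of the mass restarted in this step, r^k
      \<epsilon>, and the old shared component moved on by K; \<open>?t\<close> is the fraction of
      the former in their total 1 - r^(k+1), where r = 1 - \<epsilon>.\<close>
    let ?t = "?r ^ k * (1 - ?r) / (1 - ?r ^ k * ?r)"
    let ?c = "mixture ?t (return M u) (c \<bind> K)"
    have rk: "0 \<le> ?r ^ k" "?r ^ k \<le> 1" using \<epsilon> by (auto intro: power_le_one)
    have lt: "?r ^ k * ?r < 1"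
      using \<epsilon> rk mult_right_le_one_le[of ?r "?r ^ k"] by (smt (verit) mult.commute)
    have "\<exists>\<mu>'\<in>?P. ((\<lambda>\<nu>. \<nu> \<bind> K) ^^ Suc k) \<mu> = mixture (?r ^ Suc k) \<mu>' ?c" if \<mu>: "\<mu> \<in> ?P" for \<mu>
    proof -
      obtain \<mu>' where \<mu>': "\<mu>' \<in> ?P" "((\<lambda>\<nu>. \<nu> \<bind> K) ^^ k) \<mu> = mixture (?r ^ k) \<mu>' c"
        using cm[OF \<mu>] by blast
      have "((\<lambda>\<nu>. \<nu> \<bind> K) ^^ Suc k) \<mu> = mixture (?r ^ k) (\<mu>' \<bind> K) (c \<bind> K)"
        using \<mu>'(2) bind_mixture[OF \<mu>'(1) c K] by simp
      also have "\<dots> = mixture (?r ^ k * ?r) (\<mu>' \<bind> Q) ?c"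
        unfolding T[OF \<mu>'(1)]
        by (rule mixture_mixture[OF bind_in_prob_algebra[OF \<mu>'(1) Q] ret bind_in_prob_algebra[OF c K]])
           (use \<epsilon> rk lt in auto)
      finally show ?thesis
        using bind_in_prob_algebra[OF \<mu>'(1) Q] by (auto simp: mult.commute)
    qed
    moreover have "?c \<in> ?P" by (rule mixture_in_prob_algebra[OF ret bind_in_prob_algebra[OF c K]])
    ultimately show ?case by blast
  qed
qed

text \<open>An explicit coupling: with probability r draw the two points independently, otherwise
  draw one point from \<kappa> and use it twice. Only the first case has a cost, at most the
  diameter 1. Measurability of the distance is a hypothesis because it refers to the product of the
  Borel algebras, where it is not automatic for nonseparable spaces.\<close>

lemma W1_mixture_le:
  fixes \<mu> \<nu> \<kappa> :: "'a::metric_space measure"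
  assumes P: "\<mu> \<in> space (prob_algebra borel)" "\<nu> \<in> space (prob_algebra borel)" "\<kappa> \<in> space (prob_algebra borel)"
    and r: "0 \<le> r" "r \<le> 1"
    and dist_meas: "(\<lambda>z. dist (fst z) (snd z) :: real) \<in> borel_measurable (borel \<Otimes>\<^sub>M (borel :: 'a measure))"
    and diam: "\<And>x y :: 'a. dist x y \<le> 1"
  shows "W1 (mixture r \<mu> \<kappa>) (mixture r \<nu> \<kappa>) \<le> ennreal r"
proof -
  let ?B = "borel :: 'a measure"
  let ?prod = "\<mu> \<Otimes>\<^sub>M \<nu>" and ?diag = "distr \<kappa> (?B \<Otimes>\<^sub>M ?B) (\<lambda>x. (x, x))"
  let ?\<gamma> = "mixture r ?prod ?diag"
  have s[simp, measurable_cong]: "sets \<mu> = sets ?B" "sets \<nu> = sets ?B" "sets \<kappa> = sets ?B"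
    and pr: "prob_space \<mu>" "prob_space \<nu>" "prob_space \<kappa>"
    using P by (auto simp: space_prob_algebra)
  have prod: "?prod \<in> space (prob_algebra (?B \<Otimes>\<^sub>M ?B))"
    using pr by (auto simp: space_prob_algebra prob_space_pair intro!: sets_pair_measure_cong)
  have diag: "?diag \<in> space (prob_algebra (?B \<Otimes>\<^sub>M ?B))"
    using pr by (auto simp: space_prob_algebra intro!: prob_space.prob_space_distr)
  have \<gamma>: "?\<gamma> \<in> space (prob_algebra (?B \<Otimes>\<^sub>M ?B))" by (rule mixture_in_prob_algebra[OF prod diag])
  then have s\<gamma>[simp, measurable_cong]: "sets ?\<gamma> = sets (?B \<Otimes>\<^sub>M ?B)" by (simp add: space_prob_algebra)
  have marg: "distr ?\<gamma> borel f = mixture r \<xi> \<kappa>"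
    if f: "f \<in> ?B \<Otimes>\<^sub>M ?B \<rightarrow>\<^sub>M ?B" "distr ?prod borel f = \<xi>" "\<And>x. f (x, x) = x"
      for f \<xi>
  proof -
    have [measurable]: "f \<in> ?B \<Otimes>\<^sub>M ?B \<rightarrow>\<^sub>M ?B" by fact
    have "?\<gamma> \<bind> (\<lambda>z. return ?B (f z)) = mixture r (?prod \<bind> (\<lambda>z. return ?B (f z))) (?diag \<bind> (\<lambda>z. return ?B (f z)))"
      by (rule bind_mixture[OF prod diag]) measurable
    moreover have "m \<bind> (\<lambda>z. return ?B (f z)) = distr m ?B f"
      if "m \<in> space (prob_algebra (?B \<Otimes>\<^sub>M ?B))" for m
    proof -
      have "sets m = sets (?B \<Otimes>\<^sub>M ?B)" "prob_space m" using that by (auto simp: space_prob_algebra)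
      then show ?thesis
        using bind_return_distr[of m f ?B] f(1) prob_space.not_empty[of m]
        by (simp add: comp_def cong: measurable_cong_sets)
    qed
    moreover have "distr ?diag ?B f = \<kappa>"
      using f(3) by (subst distr_distr) (auto simp: comp_def intro!: distr_id2)
    ultimately show ?thesis using f(2) prod diag \<gamma> by simp
  qed
  have "distr ?prod borel fst = \<mu>"
    using prob_space.distr_pair_fst[OF pr(2), of \<mu>] by (simp cong: distr_cong)
  moreover have "distr ?prod borel snd = \<nu>"
  proof -
    interpret pair_prob_space \<mu> \<nu> using pr by (simp add: pair_prob_space_def pair_sigma_finite_def prob_space_imp_sigma_finite)
    have "distr ?prod borel snd = distr (distr (\<nu> \<Otimes>\<^sub>M \<mu>) ?prod (\<lambda>(x, y). (y, x))) borel snd"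
      by (subst distr_pair_swap) simp
    also have "\<dots> = distr (\<nu> \<Otimes>\<^sub>M \<mu>) borel fst"
      by (subst distr_distr) (auto simp: comp_def case_prod_beta)
    also have "\<dots> = \<nu>"
      using prob_space.distr_pair_fst[OF pr(1), of \<nu>] by (simp cong: distr_cong)
    finally show ?thesis .
  qed
  ultimately have "?\<gamma> \<in> couplings (mixture r \<mu> \<kappa>) (mixture r \<nu> \<kappa>)"
    unfolding couplings_def using \<gamma> P
    by (auto intro!: marg)
  then have "W1 (mixture r \<mu> \<kappa>) (mixture r \<nu> \<kappa>) \<le> (\<integral>\<^sup>+ z. ennreal (dist (fst z) (snd z)) \<partial>?\<gamma>)"
    unfolding W1_def by (rule INF_lower)
  also have "\<dots> = ennreal r * (\<integral>\<^sup>+ z. ennreal (dist (fst z) (snd z)) \<partial>?prod)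
      + ennreal (1 - r) * (\<integral>\<^sup>+ z. ennreal (dist (fst z) (snd z)) \<partial>?diag)"
    by (rule nn_integral_mixture[OF prod diag r]) (use dist_meas in measurable)
  also have "(\<integral>\<^sup>+ z. ennreal (dist (fst z) (snd z)) \<partial>?diag) = 0"
    using dist_meas by (subst nn_integral_distr) auto
  also have "ennreal r * (\<integral>\<^sup>+ z. ennreal (dist (fst z) (snd z)) \<partial>?prod) + ennreal (1 - r) * 0 \<le> ennreal r * 1"
  proof -
    have "(\<integral>\<^sup>+ z. ennreal (dist (fst z) (snd z)) \<partial>?prod) \<le> (\<integral>\<^sup>+ z. 1 \<partial>?prod)"
      using diam by (intro nn_integral_mono) simp
    also have "\<dots> = 1" using prob_space.emeasure_space_1[OF prob_space_pair[OF pr(1,2)]] by simp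
    finally show ?thesis using mult_left_mono[of _ 1 "ennreal r"] by simp
  qed
  finally show ?thesis by simp
qed

text \<open>The atom is assumed only after n steps, so the splitting is applied to the n-step kernel
  and then carried back to K. The rate is the n-th root of 1 - \<epsilon>, and the factor 1 / (1 -
  \<epsilon>) pays for an incomplete block of steps.\<close>

lemma uniform_atom_geometric_ergodicity:
  fixes K :: "'a::metric_space \<Rightarrow> 'a measure"
  defines "T \<equiv> \<lambda>\<mu>. \<mu> \<bind> K"
  assumes K: "K \<in> borel \<rightarrow>\<^sub>M prob_algebra borel" and \<epsilon>: "0 < \<epsilon>" "\<epsilon> < 1" and n: "0 < n"
    and atom: "\<And>x. \<epsilon> \<le> measure ((T ^^ n) (return borel x)) {u}"
    and dist_meas: "(\<lambda>z. dist (fst z) (snd z) :: real) \<in> borel_measurable (borel \<Otimes>\<^sub>M (borel :: 'a measure))"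
    and diam: "\<And>x y :: 'a. dist x y \<le> 1"
  shows "\<exists>\<pi>. (\<pi> \<in> space (prob_algebra borel) \<and> T \<pi> = \<pi>) \<and>
    (\<forall>\<pi>' \<in> space (prob_algebra borel). T \<pi>' = \<pi>' \<longrightarrow> \<pi>' = \<pi>) \<and>
    (\<exists>C > 0. \<exists>l. 0 < l \<and> l < 1 \<and> (\<forall>\<mu> \<in> space (prob_algebra borel). \<forall>k::nat.
      W1 ((T ^^ k) \<mu>) \<pi> \<le> ennreal (C * l ^ k)))"
proof -
  let ?P = "space (prob_algebra (borel :: 'a measure))"
  \<comment> \<open>The k-step kernel, obtained by starting from point masses; iterating T on laws
    is then a bind with a single kernel.\<close>
  define Kn where "Kn = (\<lambda>k x. (T ^^ k) (return borel x))"
  have TP: "T \<mu> \<in> ?P" if "\<mu> \<in> ?P" for \<mu> unfolding T_def by (rule bind_in_prob_algebra[OF that K])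
  then have TkP: "(T ^^ k) \<mu> \<in> ?P" if "\<mu> \<in> ?P" for \<mu> k using that by (induction k) auto
  have Kn: "Kn k \<in> borel \<rightarrow>\<^sub>M prob_algebra borel" for k
  proof (induction k)
    case 0 show ?case by (simp add: Kn_def measurable_return_prob_space)
  next
    case (Suc k)
    then show ?case using measurable_bind_prob_space[OF Suc K] by (simp add: Kn_def T_def)
  qed
  have TKn: "(T ^^ k) \<mu> = \<mu> \<bind> Kn k" if "\<mu> \<in> ?P" for \<mu> k
  proof (induction k)
    case 0
    have "\<mu> \<bind> return borel = \<mu> \<bind> return \<mu>"
      by (rule bind_cong) (use that in \<open>auto simp: space_prob_algebra intro: return_cong\<close>)
    then show ?case by (simp add: Kn_def bind_return')
  next
    case (Suc k)
    have "(T ^^ Suc k) \<mu> = (\<mu> \<bind> Kn k) \<bind> K" using Suc by (simp add: T_def)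
    also have "\<dots> = \<mu> \<bind> Kn (Suc k)"
      by (subst bind_assoc_prob_algebra[OF that Kn K]) (simp add: Kn_def T_def)
    finally show ?case .
  qed
  let ?T = "\<lambda>\<mu>. \<mu> \<bind> Kn n"
  have Tnk: "(?T ^^ k) \<mu> = (T ^^ (n * k)) \<mu>" if "\<mu> \<in> ?P" for \<mu> k
  proof (induction k)
    case (Suc k)
    have "(?T ^^ Suc k) \<mu> = (T ^^ n) ((T ^^ (n * k)) \<mu>)" using Suc TKn[OF TkP[OF that]] by simp
    then show ?case by (simp add: funpow_add)
  qed simp
  have at: "\<epsilon> \<le> measure (Kn n x) {u}" for x using atom by (simp add: Kn_def)
  have u: "{u} \<in> sets borel" by simp
  obtain \<pi> where \<pi>: "\<pi> \<in> ?P" "?T \<pi> = \<pi>"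
    using uniform_atom_ergodic(1)[OF Kn u \<epsilon> at] by blast
  have split: "\<exists>c\<in>?P. \<forall>\<mu>\<in>?P. \<exists>\<mu>'\<in>?P. (T ^^ (n * k)) \<mu> = mixture ((1 - \<epsilon>) ^ k) \<mu>' c" for k
    using uniform_atom_ergodic(2)[OF Kn u \<epsilon> at, of k] Tnk by fastforce
  have r01: "0 \<le> (1 - \<epsilon>) ^ k" "(1 - \<epsilon>) ^ k \<le> 1" for k using \<epsilon> by (auto intro: power_le_one)
  \<comment> \<open>Two laws invariant under \<open>T ^^ n\<close> share the component c for each k,
    so on A they differ by at most its complementary weight (1 - \<epsilon>)^k, which tends to
    0.\<close>
  have uniq: "\<mu> = \<nu>" if \<mu>: "\<mu> \<in> ?P" "(T ^^ n) \<mu> = \<mu>" and \<nu>: "\<nu> \<in> ?P" "(T ^^ n) \<nu> = \<nu>" for \<mu> \<nu>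
  proof (rule prob_measure_eqI[OF \<mu>(1) \<nu>(1)])
    fix A :: "'a set" assume A: "A \<in> sets borel"
    have fix_k: "(T ^^ (n * k)) \<xi> = \<xi>" if "(T ^^ n) \<xi> = \<xi>" for \<xi> k
      using that by (induction k) (auto simp: funpow_add)
    have "\<bar>measure \<mu> A - measure \<nu> A\<bar> \<le> (1 - \<epsilon>) ^ k" for k
    proof -
      obtain c \<mu>' \<nu>' where c: "c \<in> ?P" "\<mu>' \<in> ?P" "\<nu>' \<in> ?P"
        "\<mu> = mixture ((1 - \<epsilon>) ^ k) \<mu>' c" "\<nu> = mixture ((1 - \<epsilon>) ^ k) \<nu>' c"
        using split[of k] \<mu> \<nu> fix_k by metis
      have "measure \<mu> A - measure \<nu> A = (1 - \<epsilon>) ^ k * (measure \<mu>' A - measure \<nu>' A)"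
        by (subst c(4), subst c(5))
           (simp add: measure_mixture[OF c(2,1) r01 A] measure_mixture[OF c(3,1) r01 A] algebra_simps)
      moreover have "\<bar>measure \<mu>' A - measure \<nu>' A\<bar> \<le> 1"
        using c(2,3) prob_space.prob_le_1[of \<mu>' A] prob_space.prob_le_1[of \<nu>' A]
        by (auto simp: space_prob_algebra abs_le_iff intro: order_trans[OF _ measure_nonneg])
           (smt (verit) measure_nonneg)+
      ultimately show ?thesis
        using r01[of k] by (simp add: abs_mult mult_left_le)
    qed
    moreover have "(\<lambda>k. (1 - \<epsilon>) ^ k) \<longlonglongrightarrow> 0" using \<epsilon> by (intro LIMSEQ_realpow_zero) auto
    ultimately have "\<bar>measure \<mu> A - measure \<nu> A\<bar> \<le> 0"
      by (intro LIMSEQ_le_const) auto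
    then show "measure \<mu> A = measure \<nu> A" by simp
  qed
  have Tn\<pi>: "(T ^^ n) \<pi> = \<pi>" using TKn[OF \<pi>(1)] \<pi>(2) by simp
  \<comment> \<open>T commutes with its own power, so T \<pi> is again invariant under the power;
    uniqueness there upgrades \<pi> to a fixed point of T itself.\<close>
  have "(T ^^ n) (T \<pi>) = T \<pi>" using funpow_swap1[of T n \<pi>] Tn\<pi> by simp
  then have T\<pi>: "T \<pi> = \<pi>" by (rule uniq[OF TP[OF \<pi>(1)] _ \<pi>(1) Tn\<pi>])
  have fixed: "(T ^^ k) \<xi> = \<xi>" if "T \<xi> = \<xi>" for \<xi> k using that by (induction k) auto
  define l where "l = root n (1 - \<epsilon>)"
  have l: "0 < l" "l < 1" and ln: "l ^ n = 1 - \<epsilon>"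
    unfolding l_def using n \<epsilon> by auto
  have "W1 ((T ^^ k) \<mu>) \<pi> \<le> ennreal (1 / (1 - \<epsilon>) * l ^ k)" if \<mu>: "\<mu> \<in> ?P" for \<mu> k
  proof -
    \<comment> \<open>The k mod n leftover steps are taken first: they merely change the initial
      law, and the splitting is uniform in that law.\<close>
    let ?q = "k div n"
    obtain c \<mu>' \<nu>' where c: "c \<in> ?P" "\<mu>' \<in> ?P" "\<nu>' \<in> ?P"
      "(T ^^ (n * ?q)) ((T ^^ (k mod n)) \<mu>) = mixture ((1 - \<epsilon>) ^ ?q) \<mu>' c"
      "\<pi> = mixture ((1 - \<epsilon>) ^ ?q) \<nu>' c"
      using split[of ?q] TkP[OF \<mu>, of "k mod n"] \<pi>(1) fixed[OF T\<pi>] by metis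
    have "(T ^^ k) \<mu> = mixture ((1 - \<epsilon>) ^ ?q) \<mu>' c"
      using c(4) funpow_add[of "n * ?q" "k mod n" T] by simp
    then have W: "W1 ((T ^^ k) \<mu>) \<pi> \<le> ennreal ((1 - \<epsilon>) ^ ?q)"
      using c(5) W1_mixture_le[OF c(2,3,1) r01 dist_meas diam, of ?q] by simp
    \<comment> \<open>Since k < n * q + n, one extra factor l^n = 1 - \<epsilon> brings the exponent
      above k, and powers of l decrease.\<close>
    have "(1 - \<epsilon>) ^ ?q * (1 - \<epsilon>) \<le> l ^ k"
    proof -
      have "(1 - \<epsilon>) ^ ?q * (1 - \<epsilon>) = l ^ (n * ?q + n)" by (simp add: ln[symmetric] power_mult power_add)
      also have "\<dots> \<le> l ^ k"
        using l mod_less_divisor[OF n, of k] mult_div_mod_eq[of n k]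
        by (intro power_decreasing) linarith+
      finally show ?thesis .
    qed
    then have "ennreal ((1 - \<epsilon>) ^ ?q) \<le> ennreal (1 / (1 - \<epsilon>) * l ^ k)"
      using \<epsilon> by (intro ennreal_leI) (simp add: field_simps)
    with W show ?thesis by (rule order_trans)
  qed
  moreover have "0 < 1 / (1 - \<epsilon>)" using \<epsilon> by simp
  moreover have "\<pi>' = \<pi>" if "\<pi>' \<in> ?P" "T \<pi>' = \<pi>'" for \<pi>'
    by (rule uniq[OF that(1) fixed[OF that(2)] \<pi>(1) Tn\<pi>])
  ultimately show ?thesis using \<pi>(1) T\<pi> l by blast
qed

section \<open>The topology of ray space\<close>

lemma mat_scalar: "mat c ** A = (\<chi> i j. c * A $ i $ j)" for A :: "complex^'j^'i"
  by (simp add: vec_eq_iff matrix_matrix_mult_def mat_def if_distrib[of "\<lambda>x. x * _"] cong: if_cong)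

lemma norm_smult: "norm (c *s v) = cmod c * norm v" for v :: "complex^'i"
  by (simp add: norm_vec_def L2_set_def norm_mult power_mult_distrib real_sqrt_mult flip: sum_distrib_left)

lemma norm_unitary:
  assumes "adj U ** U = mat 1"
  shows "norm (U *v v) = norm v"
proof -
  have "cinner (U *v v) (U *v v) = cinner v v"
    using assms by (simp add: cinner_adj matrix_vector_mul_assoc)
  then have "(norm (U *v v))\<^sup>2 = (norm v)\<^sup>2"
    unfolding cinner_self of_real_eq_iff .
  then show ?thesis by simp
qed

lemma outer_matrix_vector: "outer (A *v u) (A *v v) = A ** outer u v ** adj A"
  by (simp add: vec_eq_iff outer_def matrix_matrix_mult_def matrix_vector_mult_def adj_def
      sum_distrib_left sum_distrib_right mult_ac)

lemma ray_of_smult: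
  assumes "c \<noteq> 0" "v \<noteq> 0"
  shows "ray_of (c *s v) = ray_of v"
  by (rule Quotient_rel_abs[OF Quotient_ray, symmetric]) (use assms in auto)

lemma unit_rep_nonzero: "unit_rep x \<noteq> 0"
  using unit_rep(1)[of x] by auto

lemma unit_rep_ray_of:
  assumes "w \<noteq> 0"
  obtains c where "unit_rep (ray_of w) = c *s w" "cmod c = 1 / norm w"
proof -
  let ?v = "unit_rep (ray_of w)"
  have "w \<noteq> 0 \<and> ?v \<noteq> 0 \<and> (\<exists>c. ?v = c *s w)"
    using Quotient_rel[OF Quotient_ray, of w ?v] assms unit_rep(2)[of "ray_of w"] unit_rep_nonzero[of "ray_of w"]
    by (auto intro: exI[of _ 1])
  then obtain c where c: "?v = c *s w" by blast
  then have "cmod c * norm w = 1" using unit_rep(1)[of "ray_of w"] by (simp add: norm_smult)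
  then have "cmod c = 1 / norm w" using assms by (simp add: field_simps)
  with c show thesis by (rule that)
qed

lemma density_ray_of:
  assumes "w \<noteq> 0"
  shows "density (ray_of w) = (1 / (norm w)\<^sup>2) *\<^sub>R outer w w"
proof -
  obtain c where c: "unit_rep (ray_of w) = c *s w" "cmod c = 1 / norm w"
    by (rule unit_rep_ray_of[OF assms])
  have "outer (c *s w) (c *s w) = (cmod c)\<^sup>2 *\<^sub>R outer w w"
    by (simp add: vec_eq_iff outer_def scaleR_conv_of_real[where 'a=complex] complex_norm_square mult_ac
        del: of_real_power)
  then show ?thesis unfolding density_def c(1) by (simp add: c(2) power_divide)
qed

text \<open>\<open>unit_rep\<close> is an arbitrary choice of phase without any continuity, so
  topological arguments go through \<open>density\<close>, which embeds the rays into matrix space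
  as a similarity. The factor sqrt 2 is the ratio of the Frobenius norm to half the trace norm for a
  difference of two pure states.\<close>

lemma dist_density: "dist (density x) (density y) = sqrt 2 * dist x y"
  unfolding dist_ray_def trace_norm_density by (simp add: dist_norm)

lemma continuous_on_density: "continuous_on S density"
  unfolding continuous_on_iff dist_density
proof (intro ballI allI impI)
  fix x :: "'a ray" and e :: real assume "0 < e"
  then show "\<exists>d>0. \<forall>x'\<in>S. dist x' x < d \<longrightarrow> sqrt 2 * dist x' x < e"
    by (intro exI[of _ "e / sqrt 2"]) (auto simp: field_simps)
qed

lemma continuous_on_ray:
  fixes f :: "'a::metric_space \<Rightarrow> 'i::finite ray"
  assumes "continuous_on S (\<lambda>x. density (f x))"
  shows "continuous_on S f"
  unfolding continuous_on_iff
proof (intro ballI allI impI)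
  fix x and e :: real assume "x \<in> S" "0 < e"
  then obtain d where "d > 0" "\<And>x'. x' \<in> S \<Longrightarrow> dist x' x < d \<Longrightarrow> dist (density (f x')) (density (f x)) < e * sqrt 2"
    using assms unfolding continuous_on_iff by (metis mult_pos_pos real_sqrt_gt_0_iff zero_less_numeral)
  then show "\<exists>d>0. \<forall>x'\<in>S. dist x' x < d \<longrightarrow> dist (f x') (f x) < e"
    by (intro exI[of _ d]) (auto simp: dist_density mult.commute)
qed

lemma dist_ray_le_1: "dist x y \<le> 1" for x y :: "'i::finite ray"
  unfolding dist_ray_eq by simp

text \<open>Through the embedding this becomes the distance in a finite-dimensional, hence second
  countable, matrix space.\<close>

lemma measurable_dist_ray:
  "(\<lambda>z. dist (fst z) (snd z)) \<in> borel_measurable (borel \<Otimes>\<^sub>M (borel :: 'i::finite ray measure))"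
proof -
  have [measurable]: "density \<in> borel \<rightarrow>\<^sub>M (borel :: (complex^'i^'i) measure)"
    by (rule borel_measurable_continuous_onI) (rule continuous_on_density)
  have "dist x y = dist (density x) (density y) / sqrt 2" for x y :: "'i ray"
    by (simp add: dist_density)
  then show ?thesis by simp
qed

lemma continuous_on_matrix_mult [continuous_intros]:
  fixes f :: "'a::topological_space \<Rightarrow> complex^'j^'i" and g :: "'a \<Rightarrow> complex^'k^'j"
  assumes "continuous_on S f" "continuous_on S g"
  shows "continuous_on S (\<lambda>x. f x ** g x)"
  unfolding matrix_matrix_mult_def
  by (intro continuous_on_vec_lambda continuous_intros assms)

lemma continuous_on_trace [continuous_intros]:
  fixes f :: "'a::topological_space \<Rightarrow> complex^'i^'i"
  assumes "continuous_on S f"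
  shows "continuous_on S (\<lambda>x. trace (f x))"
  unfolding trace_def by (intro continuous_intros assms)

text \<open>Expresses the weight through the density alone; the chosen phase disappears and
  continuity is visible.\<close>

lemma norm_matrix_unit_rep:
  "(norm (A *v unit_rep x))\<^sup>2 = Re (trace (A ** density x ** adj A))"
  by (simp add: density_def flip: outer_matrix_vector) (simp add: trace_outer cinner_self flip: of_real_power)

lemma continuous_on_matrix_weight: "continuous_on S (\<lambda>x. (norm (A *v unit_rep x))\<^sup>2)"
  unfolding norm_matrix_unit_rep by (intro continuous_intros continuous_on_density)

lemma continuous_on_matrix_action:
  fixes A :: "complex^'i::finite^'i"
  shows "continuous_on {x. A *v unit_rep x \<noteq> 0} (\<lambda>x. ray_of (A *v unit_rep x))"
proof (rule continuous_on_ray)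
  have "continuous_on {x. A *v unit_rep x \<noteq> 0}
    (\<lambda>x. (1 / (norm (A *v unit_rep x))\<^sup>2) *\<^sub>R (A ** density x ** adj A))"
    by (intro continuous_intros continuous_on_density continuous_on_matrix_weight) auto
  then show "continuous_on {x. A *v unit_rep x \<noteq> 0} (\<lambda>x. density (ray_of (A *v unit_rep x)))"
    by (rule continuous_on_cong[THEN iffD1, rotated 2])
       (simp_all add: density_ray_of outer_matrix_vector, simp add: density_def)
qed

text \<open>The action is continuous only where A does not annihilate the state. Elsewhere the
  weight vanishes, so there the image may be replaced by the constant \<open>ray_of 1\<close>
  without changing the product.\<close>

lemma measurable_matrix_branch:
  fixes A :: "complex^'i::finite^'i"
  assumes "B \<in> sets borel"
  shows "(\<lambda>x. (norm (A *v unit_rep x))\<^sup>2 * indicator B (ray_of (A *v unit_rep x)) :: real) \<in> borel_measurable borel"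
proof -
  let ?S = "{x. A *v unit_rep x \<noteq> 0}"
  have w[measurable]: "(\<lambda>x. (norm (A *v unit_rep x))\<^sup>2) \<in> borel_measurable borel"
    by (rule borel_measurable_continuous_onI[OF continuous_on_matrix_weight])
  have S: "?S = {x \<in> space borel. (norm (A *v unit_rep x))\<^sup>2 \<noteq> 0}" by simp
  have "?S \<in> sets borel" unfolding S by measurable
  then have "(\<lambda>x. if x \<in> ?S then ray_of (A *v unit_rep x) else ray_of 1) \<in> borel_measurable borel"
    by (rule borel_measurable_continuous_on_if[OF _ continuous_on_matrix_action continuous_on_const])
  then have "(\<lambda>x. (norm (A *v unit_rep x))\<^sup>2
      * indicator B (if x \<in> ?S then ray_of (A *v unit_rep x) else ray_of 1) :: real) \<in> borel_measurable borel"
    using assms by measurable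
  then show ?thesis
    by (rule measurable_cong[THEN iffD1, rotated]) auto
qed

section \<open>The Clifford group\<close>

lemma mat_mult_mat: "mat a ** mat b = (mat (a * b) :: complex^'i^'i)"
  unfolding mat_scalar by (simp add: vec_eq_iff mat_def)

lemma mat_scalar_commute: "A ** mat c = mat c ** A" for A :: "complex^'i^'i"
  unfolding mat_scalar
  by (simp add: vec_eq_iff matrix_matrix_mult_def mat_def if_distrib[of "\<lambda>x. _ * x"] mult.commute cong: if_cong)

lemma adj_mat: "adj (mat c) = mat (cnj c)"
  by (auto simp: vec_eq_iff adj_def mat_def)

lemma adj_adj: "adj (adj A) = A"
  by (simp add: vec_eq_iff adj_def)

lemma det_mat: "det (mat c :: complex^'i^'i) = c ^ CARD('i)"
  by (subst det_diagonal) (auto simp: mat_def)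

section \<open>The unitary group and its quotient by phases\<close>

lemma unitary_carrier: "U \<in> carrier unitary_group \<longleftrightarrow> adj U ** U = mat 1 \<and> U ** adj U = mat 1"
  by (simp add: unitary_group_def)

lemma unitary_mult:
  "U \<in> carrier unitary_group \<Longrightarrow> V \<in> carrier unitary_group \<Longrightarrow> U ** V \<in> carrier unitary_group"
  by (simp add: unitary_carrier adj_mult) (metis matrix_mul_assoc matrix_mul_lid)

lemma unitary_adj: "U \<in> carrier unitary_group \<Longrightarrow> adj U \<in> carrier unitary_group"
  by (simp add: unitary_carrier adj_adj)

lemma unitary_matpow: "U \<in> carrier unitary_group \<Longrightarrow> matpow U n \<in> carrier unitary_group"
proof (induction n)
  case 0
  show ?case by (simp add: matpow_def unitary_carrier adj_mat)
next
  case (Suc n)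
  then show ?case using unitary_mult[of U "matpow U n"] by (simp add: matpow_def)
qed

lemma group_unitary: "group unitary_group"
proof (rule groupI)
  fix U :: "complex^'i^'i" assume "U \<in> carrier unitary_group"
  then show "\<exists>V\<in>carrier unitary_group. V \<otimes>\<^bsub>unitary_group\<^esub> U = \<one>\<^bsub>unitary_group\<^esub>"
    using unitary_adj by (intro bexI[of _ "adj U"]) (auto simp: unitary_group_def)
qed (use unitary_mult in \<open>auto simp: unitary_group_def matrix_mul_assoc adj_mat\<close>)

lemma inv_unitary: "U \<in> carrier unitary_group \<Longrightarrow> inv\<^bsub>unitary_group\<^esub> U = adj U"
  by (rule group.inv_equality[OF group_unitary])
     (use unitary_adj in \<open>auto simp: unitary_group_def\<close>)

lemma phase_unitary: "cmod c = 1 \<Longrightarrow> mat c \<in> carrier unitary_group"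
  by (simp add: unitary_carrier adj_mat mat_mult_mat complex_norm_square[symmetric] mult.commute[of "cnj c"])

lemma phases_normal: "phases \<lhd> unitary_group"
proof -
  interpret group unitary_group by (rule group_unitary)
  have sub: "subgroup phases unitary_group"
  proof (rule subgroupI)
    show "phases \<subseteq> carrier unitary_group" by (auto simp: phases_def phase_unitary)
    show "phases \<noteq> {}" by (auto simp: phases_def intro: exI[of _ 1])
    fix a b :: "complex^'i^'i" assume a: "a \<in> phases"
    then obtain c where "a = mat c" "cmod c = 1" by (auto simp: phases_def)
    then show "inv\<^bsub>unitary_group\<^esub> a \<in> phases"
      by (auto simp: inv_unitary phase_unitary adj_mat phases_def)
    assume "b \<in> phases"
    with a show "a \<otimes>\<^bsub>unitary_group\<^esub> b \<in> phases"
      by (auto simp: phases_def unitary_group_def mat_mult_mat norm_mult)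
  qed
  show ?thesis
    unfolding normal_inv_iff
  proof (intro conjI ballI sub)
    fix U h :: "complex^'i^'i" assume U: "U \<in> carrier unitary_group" and "h \<in> phases"
    then obtain c where c: "h = mat c" "cmod c = 1" by (auto simp: phases_def)
    have "U ** h ** adj U = h ** (U ** adj U)"
      unfolding c(1) mat_scalar_commute[of U c] by (simp add: matrix_mul_assoc)
    then have "U ** h ** adj U = h" using U by (simp add: unitary_carrier)
    then show "U \<otimes>\<^bsub>unitary_group\<^esub> h \<otimes>\<^bsub>unitary_group\<^esub> inv\<^bsub>unitary_group\<^esub> U \<in> phases"
      using c U unfolding inv_unitary[OF U] by (auto simp: unitary_group_def phases_def)
  qed
qed

lemma proj_class_def': "proj_class U = {mat c ** U | c. cmod c = 1}"
  by (auto simp: proj_class_def r_coset_def phases_def unitary_group_def)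

lemma proj_class_self: "U \<in> proj_class U"
  unfolding proj_class_def' by (auto intro: exI[of _ 1])

lemma proj_class_phase: "cmod c = 1 \<Longrightarrow> proj_class (mat c ** U) = proj_class U"
proof -
  assume c: "cmod c = 1"
  then have c0: "c \<noteq> 0" by auto
  show ?thesis
    unfolding proj_class_def'
  proof safe
    fix b assume "cmod b = 1"
    then show "\<exists>b'. mat b ** (mat c ** U) = mat b' ** U \<and> cmod b' = 1"
      using c by (intro exI[of _ "b * c"]) (simp add: matrix_mul_assoc mat_mult_mat norm_mult)
    show "\<exists>b'. mat b ** U = mat b' ** (mat c ** U) \<and> cmod b' = 1"
      using c c0 \<open>cmod b = 1\<close>
      by (intro exI[of _ "b / c"]) (simp add: matrix_mul_assoc mat_mult_mat norm_divide)
  qed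
qed

lemma proj_class_eqI: "V \<in> proj_class U \<Longrightarrow> proj_class V = proj_class U"
  using proj_class_phase[of _ U] by (auto simp: proj_class_def'[of U])

lemma PU_group: "group PU"
  unfolding PU_def by (rule normal.factorgroup_is_group[OF phases_normal])

lemma PU_carrier: "carrier PU = proj_class ` carrier unitary_group"
  by (auto simp: PU_def FactGroup_def RCOSETS_def proj_class_def)

lemma PU_mult:
  "U \<in> carrier unitary_group \<Longrightarrow> V \<in> carrier unitary_group \<Longrightarrow>
    proj_class U \<otimes>\<^bsub>PU\<^esub> proj_class V = proj_class (U ** V)"
  using normal.rcos_sum[OF phases_normal, of U V]
  by (simp add: PU_def proj_class_def) (simp add: unitary_group_def)

lemma PU_inv:
  assumes U: "U \<in> carrier unitary_group"
  shows "inv\<^bsub>PU\<^esub> proj_class U = proj_class (adj U)"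
proof -
  have "proj_class U \<in> carrier (unitary_group Mod phases)"
    using U PU_carrier by (auto simp: PU_def)
  then show ?thesis
    using normal.inv_FactGroup[OF phases_normal, of "proj_class U"] normal.rcos_inv[OF phases_normal U]
    by (simp add: PU_def proj_class_def inv_unitary[OF U])
qed

subsection \<open>Tensor products\<close>

text \<open>A sum over all configurations of a product over sites factorises into one sum for each
  site.\<close>

lemma tensor_op_mult: "tensor_op A ** tensor_op B = tensor_op (\<lambda>j. A j ** B j)"
proof -
  have "(\<Sum>u\<in>UNIV. (\<Prod>j\<in>UNIV. A j $ s j $ u j) * (\<Prod>j\<in>UNIV. B j $ u j $ t j))
    = (\<Prod>j\<in>UNIV. \<Sum>k\<in>UNIV. A j $ s j $ k * B j $ k $ t j)" for s t :: "'a \<Rightarrow> 'b mod_ring"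
    by (subst prod_sum_PiE) (auto simp: PiE_def Pi_def extensional_def prod.distrib)
  then show ?thesis
    by (simp add: vec_eq_iff tensor_op_def matrix_matrix_mult_def)
qed

lemma tensor_op_adj: "adj (tensor_op A) = tensor_op (\<lambda>j. adj (A j))"
  by (simp add: vec_eq_iff tensor_op_def adj_def)

lemma tensor_op_id: "tensor_op (\<lambda>_. mat 1) = (mat 1 :: ('n::finite, 'd::finite) op)"
proof -
  have "(\<Prod>j\<in>UNIV. mat 1 $ s j $ t j) = (if s = t then 1 else (0::complex))" for s t :: "'n \<Rightarrow> 'd mod_ring"
    by (auto simp: mat_def fun_eq_iff prod_zero_iff)
  then show ?thesis by (simp add: vec_eq_iff tensor_op_def) (simp add: mat_def)
qed

lemma tensor_op_smult: "tensor_op (\<lambda>j. mat (c j) ** A j) = mat (\<Prod>j\<in>UNIV. c j) ** tensor_op A"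
  unfolding mat_scalar by (simp add: vec_eq_iff tensor_op_def prod.distrib)

lemma tensor_op_unitary:
  "(\<And>j. A j \<in> carrier unitary_group) \<Longrightarrow> tensor_op A \<in> carrier unitary_group"
  by (simp add: unitary_carrier tensor_op_adj tensor_op_mult tensor_op_id)

section \<open>Operators on one site and permutations of the sites\<close>

definition site_op :: "'n::finite \<Rightarrow> 'd::finite qudit_op \<Rightarrow> ('n, 'd) op" where
  "site_op i A = tensor_op (\<lambda>j. if j = i then A else mat 1)"

lemma on_first_site: "on_first A = site_op (Min UNIV) A"
  by (simp add: on_first_def site_op_def)

lemma site_op_mult: "site_op i A ** site_op i B = site_op i (A ** B)"
  unfolding site_op_def tensor_op_mult by (intro arg_cong[where f=tensor_op]) auto

text \<open>Sends the basis vector of t to that of t o \<sigma>. It is used only for involutions,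
  where the direction of the relabelling is immaterial and the operator is its own adjoint and
  inverse.\<close>

definition perm_op :: "('n \<Rightarrow> 'n::finite) \<Rightarrow> ('n, 'd::finite) op" where
  "perm_op \<sigma> = (\<chi> s t. if s = t \<circ> \<sigma> then 1 else 0)"

lemma perm_op_conj:
  fixes \<sigma> :: "'n::finite \<Rightarrow> 'n" and X :: "('n, 'd::finite) op"
  assumes "\<sigma> \<circ> \<sigma> = id"
  shows "perm_op \<sigma> ** X ** perm_op \<sigma> = (\<chi> s t. X $ (s \<circ> \<sigma>) $ (t \<circ> \<sigma>))"
proof -
  have "s = u \<circ> \<sigma> \<longleftrightarrow> u = s \<circ> \<sigma>" for s u :: "'n \<Rightarrow> 'd mod_ring"
    using assms by (metis comp_assoc comp_id)
  then have entry: "perm_op \<sigma> $ s $ u = (if u = s \<circ> \<sigma> then 1 else 0)" for s u :: "'n \<Rightarrow> 'd mod_ring"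
    by (simp add: perm_op_def)
  have "perm_op \<sigma> ** X = (\<chi> s t. X $ (s \<circ> \<sigma>) $ t)"
    by (simp add: vec_eq_iff entry matrix_matrix_mult_def if_distrib[of "\<lambda>x. x * _"] cong: if_cong)
  then show ?thesis
    by (simp add: vec_eq_iff perm_op_def matrix_matrix_mult_def if_distrib[of "\<lambda>x. _ * x"] cong: if_cong)
qed

lemma perm_op_tensor:
  fixes \<sigma> :: "'n::finite \<Rightarrow> 'n" and A :: "'n \<Rightarrow> 'd::finite qudit_op"
  assumes "\<sigma> \<circ> \<sigma> = id"
  shows "perm_op \<sigma> ** tensor_op A ** perm_op \<sigma> = tensor_op (A \<circ> \<sigma>)"
proof -
  have inv: "\<sigma> (\<sigma> j) = j" for j using assms by (metis comp_apply id_apply)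
  have bij: "bij_betw \<sigma> UNIV UNIV" by (rule bij_betw_byWitness[where f'=\<sigma>]) (auto simp: inv)
  have "(\<Prod>j\<in>UNIV. A j $ s (\<sigma> j) $ t (\<sigma> j)) = (\<Prod>j\<in>UNIV. A (\<sigma> j) $ s j $ t j)" for s t :: "'n \<Rightarrow> 'd mod_ring"
    by (rule prod.reindex_bij_betw[OF bij, symmetric, of "\<lambda>j. A j $ s (\<sigma> j) $ t (\<sigma> j)", unfolded inv])
  then show ?thesis
    unfolding perm_op_conj[OF assms] by (simp add: vec_eq_iff tensor_op_def)
qed

lemma perm_op_adj:
  fixes \<sigma> :: "'n::finite \<Rightarrow> 'n"
  assumes "\<sigma> \<circ> \<sigma> = id"
  shows "adj (perm_op \<sigma>) = (perm_op \<sigma> :: ('n, 'd::finite) op)"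
proof -
  have "s = u \<circ> \<sigma> \<longleftrightarrow> u = s \<circ> \<sigma>" for s u :: "'n \<Rightarrow> 'd mod_ring"
    using assms by (metis comp_assoc comp_id)
  then show ?thesis by (auto simp: vec_eq_iff perm_op_def adj_def)
qed

lemma perm_op_unitary:
  fixes \<sigma> :: "'n::finite \<Rightarrow> 'n"
  assumes "\<sigma> \<circ> \<sigma> = id"
  shows "(perm_op \<sigma> :: ('n, 'd::finite) op) \<in> carrier unitary_group"
proof -
  have "perm_op \<sigma> ** mat 1 ** perm_op \<sigma> = (mat 1 :: ('n, 'd) op)"
    using perm_op_tensor[OF assms, of "\<lambda>_. mat 1"] by (simp add: tensor_op_id comp_def)
  then show ?thesis by (simp add: unitary_carrier perm_op_adj[OF assms])
qed

text \<open>Swaps are what allows the circuit, which rotates and measures only the first site, to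
  act on any site.\<close>

lemma site_op_conj_transpose:
  "perm_op (Transposition.transpose i j) ** site_op i A ** perm_op (Transposition.transpose i j) = site_op j A"
proof -
  have "(\<lambda>k. if k = i then A else mat 1) \<circ> Transposition.transpose i j = (\<lambda>k. if k = j then A else mat 1)"
    by (auto simp: fun_eq_iff Transposition.transpose_def)
  then show ?thesis
    unfolding site_op_def by (subst perm_op_tensor) (auto simp: transpose_comp_involutory)
qed

subsection \<open>The additive character of the prime field\<close>

text \<open>The additive character of the prime field. Passing to representatives is harmless
  because \<open>omega\<close> is a primitive root of unity of order CARD('d).\<close>

definition chi :: "'d::prime_card mod_ring \<Rightarrow> complex" where
  "chi x = omega TYPE('d) ^ rep x"

lemma rep_of_nat: "rep (of_nat n :: 'd::prime_card mod_ring) = n mod CARD('d)"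
  unfolding rep_def by transfer (simp add: nat_mod_distrib)

lemma of_nat_rep: "of_nat (rep x) = (x :: 'd::prime_card mod_ring)"
  unfolding rep_def by transfer (auto simp: nat_mod_distrib)

lemma omega_power: "omega TYPE('d::prime_card) ^ n = exp (2 * of_real pi * \<i> * of_nat n / of_nat CARD('d))"
  unfolding omega_def exp_of_nat_mult[symmetric] by (simp add: mult_ac)

lemma omega_power_eq:
  "omega TYPE('d::prime_card) ^ m = omega TYPE('d) ^ n \<longleftrightarrow> m mod CARD('d) = n mod CARD('d)"
  unfolding omega_power by (rule complex_root_unity_eq) (simp add: Suc_leI)

lemma chi_of_nat: "chi (of_nat n :: 'd::prime_card mod_ring) = omega TYPE('d) ^ n"
  unfolding chi_def omega_power_eq rep_of_nat by simp

lemma chi_add: "chi (x + y) = chi x * chi y"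
  by (subst (1 2) of_nat_rep[symmetric]) (simp only: of_nat_add[symmetric] chi_of_nat power_add, simp add: chi_def)

lemma chi_0: "chi 0 = 1"
  using chi_of_nat[of 0] by simp

lemma chi_inj: "chi x = chi y \<longleftrightarrow> x = y"
  using chi_of_nat[of "rep x"] chi_of_nat[of "rep y"]
  by (metis omega_power_eq of_nat_rep rep_of_nat)

lemma cmod_chi: "cmod (chi x) = 1"
  unfolding chi_def norm_power omega_def by simp

lemma chi_nonzero: "chi x \<noteq> 0"
  using cmod_chi[of x] by auto

lemma cnj_chi: "cnj (chi x) = chi (- x)"
proof -
  have "chi x * cnj (chi x) = 1" using complex_norm_square[of "chi x"] by (simp add: cmod_chi)
  moreover have "chi x * chi (- x) = 1" by (simp add: chi_0 flip: chi_add)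
  ultimately show ?thesis using chi_nonzero[of x] by (metis mult_cancel_left)
qed

text \<open>Orthogonality of characters: shifting k by 1 multiplies the sum by \<open>chi c\<close>,
  which differs from 1 unless c = 0.\<close>

lemma chi_sum: "(\<Sum>k\<in>UNIV. chi (c * k)) = (if c = 0 then of_nat CARD('d) else 0)"
  for c :: "'d::prime_card mod_ring"
proof (cases "c = 0")
  case False
  have "(\<Sum>k\<in>UNIV. chi (c * k)) = (\<Sum>k\<in>UNIV. chi (c * (k + 1)))"
    by (rule sum.reindex_bij_witness[of _ "\<lambda>k. k + 1" "\<lambda>k. k - 1"]) auto
  also have "\<dots> = (\<Sum>k\<in>UNIV. chi (c * k)) * chi c"
    by (simp add: distrib_left chi_add sum_distrib_right)
  finally have "(\<Sum>k\<in>UNIV. chi (c * k)) * (1 - chi c) = 0" by (simp add: algebra_simps)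
  moreover have "chi c \<noteq> 1" using chi_inj[of c 0] False by (simp add: chi_0)
  ultimately show ?thesis using False by simp
qed (simp add: chi_0)

lemma chi_power: "chi x ^ rep y = chi (x * y)" for x y :: "'d::prime_card mod_ring"
proof -
  have "chi x ^ rep y = chi (of_nat (rep x * rep y) :: 'd mod_ring)"
    by (simp only: chi_of_nat power_mult) (simp add: chi_def)
  then show ?thesis by (simp add: of_nat_rep)
qed

lemma F_op_entry: "F_op $ j $ k = chi (j * k) / sqrt CARD('d)" for j :: "'d::prime_card mod_ring"
  by (simp add: F_op_def chi_def)

lemma sqrt_card_square: "complex_of_real (sqrt CARD('d::prime_card)) * complex_of_real (sqrt CARD('d)) = of_nat CARD('d)"
  by (simp flip: of_real_mult)

lemma F_op_unitary: "F_op \<in> carrier (unitary_group :: 'd::prime_card qudit_op monoid)"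
proof -
  have "(\<Sum>k\<in>UNIV. chi (l * k) * chi (- (k * j))) = (if l = j then of_nat CARD('d) else 0)"
    "(\<Sum>k\<in>UNIV. chi (- (k * l)) * chi (k * j)) = (if l = j then of_nat CARD('d) else 0)" for l j :: "'d mod_ring"
    using chi_sum[of "l - j"] chi_sum[of "j - l"] by (simp_all add: algebra_simps flip: chi_add)
  then show ?thesis
    by (simp add: unitary_carrier vec_eq_iff matrix_matrix_mult_def adj_def F_op_entry cnj_chi mat_def
        sqrt_card_square mult_ac flip: sum_divide_distrib)
qed

lemma Z_op_entry: "Z_op $ j $ k = (if j = k then chi k else 0)"
  by (simp add: Z_op_def chi_def)

lemma Z_op_unitary: "Z_op \<in> carrier unitary_group"
  by (simp add: unitary_carrier vec_eq_iff matrix_matrix_mult_def adj_def Z_op_entry cnj_chi mat_def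
      if_distrib[of "\<lambda>x. x * _"] if_distrib[of cnj] chi_0 flip: chi_add cong: if_cong)

lemma X_op_entry: "X_op $ j $ k = (if j = k + 1 then 1 else 0)"
  by (simp add: X_op_def)

lemma X_op_unitary: "X_op \<in> carrier (unitary_group :: 'd::prime_card qudit_op monoid)"
proof -
  have e: "j = k + 1 \<longleftrightarrow> k = j - 1" for j k :: "'d mod_ring" by auto
  have "(\<Sum>k\<in>UNIV. (if i = k + 1 then 1 else 0) * (if j = k + 1 then 1 else 0)) = (if i = j then 1 else (0::complex))"
    for i j :: "'d mod_ring"
    by (simp add: e if_distrib[of "\<lambda>x. x * _"] cong: if_cong)
  moreover have "(\<Sum>k\<in>UNIV. (if k = i + 1 then 1 else 0) * (if k = j + 1 then 1 else 0)) = (if i = j then 1 else (0::complex))"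
    for i j :: "'d mod_ring"
    by (simp add: if_distrib[of "\<lambda>x. x * _"] cong: if_cong)
  ultimately show ?thesis
    by (simp add: unitary_carrier vec_eq_iff matrix_matrix_mult_def adj_def X_op_entry mat_def if_distrib[of cnj] cong: if_cong)
qed

section \<open>Weyl operators, the tensor factors of the Pauli operators\<close>

definition weyl :: "'d::prime_card mod_ring \<Rightarrow> 'd mod_ring \<Rightarrow> 'd qudit_op" where
  "weyl q p = matpow Z_op (rep p) ** matpow X_op (rep q)"

lemma matpow_Z: "matpow Z_op n $ j $ k = (if j = k then chi k ^ n else 0)" for j k :: "'d::prime_card mod_ring"
proof (induction n arbitrary: j)
  case 0
  show ?case by (simp add: matpow_def mat_def)
next
  case (Suc n)
  have "matpow Z_op (Suc n) = Z_op ** matpow (Z_op :: 'd qudit_op) n" by (simp add: matpow_def)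
  then show ?case
    by (simp add: matrix_matrix_mult_def Suc Z_op_entry if_distrib[of "\<lambda>x. x * _"] cong: if_cong)
qed

lemma matpow_X: "matpow X_op n $ j $ k = (if j = k + of_nat n then 1 else 0)" for j k :: "'d::prime_card mod_ring"
proof (induction n arbitrary: j)
  case 0
  show ?case by (simp add: matpow_def mat_def)
next
  case (Suc n)
  have "matpow X_op (Suc n) = X_op ** matpow (X_op :: 'd qudit_op) n" by (simp add: matpow_def)
  then show ?case
    by (simp add: matrix_matrix_mult_def Suc X_op_entry if_distrib[of "\<lambda>x. _ * x"] add_ac cong: if_cong)
qed

lemma weyl_entry: "weyl q p $ j $ k = (if j = k + q then chi (p * j) else 0)"
  by (simp add: weyl_def matrix_matrix_mult_def matpow_Z matpow_X chi_power of_nat_rep mult.commute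
      if_distrib[of "\<lambda>x. x * _"] cong: if_cong)

lemma weyl_unitary: "weyl q p \<in> carrier unitary_group"
  unfolding weyl_def by (intro unitary_mult unitary_matpow Z_op_unitary X_op_unitary)

lemma pauli_op_weyl: "pauli_op q p = tensor_op (\<lambda>j. weyl (q j) (p j))"
  by (simp add: pauli_op_def weyl_def)

lemma pauli_op_unitary: "pauli_op q p \<in> carrier unitary_group"
  unfolding pauli_op_weyl by (intro tensor_op_unitary weyl_unitary)

text \<open>Conjugation by F turns X into Z and Z into the inverse of X, a quarter turn (q, p) ->
  (-p, q) of phase space. The phase comes from moving the power of Z back to the left of the power
  of X.\<close>

lemma F_op_weyl: "F_op ** weyl q p ** adj F_op = mat (chi (p * q)) ** weyl (- p) q"
proof -
  have "(\<Sum>k\<in>UNIV. (\<Sum>m\<in>UNIV. F_op $ j $ m * weyl q p $ m $ k) * cnj (F_op $ l $ k))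
    = chi (p * q) * weyl (- p) q $ j $ l" for j l
  proof -
    have "(\<Sum>m\<in>UNIV. F_op $ j $ m * weyl q p $ m $ k) = chi ((j + p) * (k + q)) / sqrt CARD('a)" for k
      by (simp add: F_op_entry weyl_entry if_distrib[of "\<lambda>x. _ * x"] distrib_right chi_add cong: if_cong)
    then have "(\<Sum>k\<in>UNIV. (\<Sum>m\<in>UNIV. F_op $ j $ m * weyl q p $ m $ k) * cnj (F_op $ l $ k))
      = (\<Sum>k\<in>UNIV. chi ((j + p) * q) * chi ((j + p - l) * k) / of_nat CARD('a))"
      by (intro sum.cong) (auto simp: F_op_entry cnj_chi sqrt_card_square algebra_simps simp flip: chi_add)
    also have "\<dots> = chi ((j + p) * q) * (\<Sum>k\<in>UNIV. chi ((j + p - l) * k)) / of_nat CARD('a)"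
      by (simp add: sum_distrib_left sum_divide_distrib)
    also have "\<dots> = chi (p * q) * weyl (- p) q $ j $ l"
      unfolding chi_sum by (auto simp: weyl_entry algebra_simps chi_add[symmetric])
    finally show ?thesis .
  qed
  then show ?thesis
    unfolding mat_scalar by (simp add: vec_eq_iff matrix_matrix_mult_def adj_def)
qed

subsection \<open>Clifford unitaries\<close>

text \<open>The normalizer condition on the level of unitaries. It only asks that Pauli operators go
  to Pauli operators up to a phase; that the projective Pauli group is mapped onto itself follows
  from its finiteness.\<close>

definition clifford :: "('n::finite, 'd::prime_card) op \<Rightarrow> bool" where
  "clifford U \<longleftrightarrow> U \<in> carrier unitary_group \<and>
    (\<forall>q p. \<exists>c q' p'. cmod c = 1 \<and> U ** pauli_op q p ** adj U = mat c ** pauli_op q' p')"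

lemma clifford_unitary: "clifford U \<Longrightarrow> U \<in> carrier unitary_group"
  by (simp add: clifford_def)

lemma clifford_mult:
  assumes U: "clifford U" and V: "clifford V"
  shows "clifford (U ** V)"
  unfolding clifford_def
proof (intro conjI allI unitary_mult clifford_unitary assms)
  fix q p
  obtain c q' p' where c: "cmod c = 1" "V ** pauli_op q p ** adj V = mat c ** pauli_op q' p'"
    using V unfolding clifford_def by blast
  obtain b q'' p'' where b: "cmod b = 1" "U ** pauli_op q' p' ** adj U = mat b ** pauli_op q'' p''"
    using U unfolding clifford_def by blast
  have "U ** V ** pauli_op q p ** adj (U ** V) = U ** (V ** pauli_op q p ** adj V) ** adj U"
    by (simp add: adj_mult matrix_mul_assoc)
  also have "\<dots> = mat c ** (U ** pauli_op q' p' ** adj U)"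
    unfolding c(2) matrix_mul_assoc mat_scalar_commute[of U c] by simp
  also have "\<dots> = mat (c * b) ** pauli_op q'' p''"
    unfolding b(2) by (simp add: matrix_mul_assoc mat_mult_mat)
  finally show "\<exists>c q' p'. cmod c = 1 \<and> U ** V ** pauli_op q p ** adj (U ** V) = mat c ** pauli_op q' p'"
    using b c by (intro exI[of _ "c * b"]) (auto simp: norm_mult)
qed

lemma clifford_perm_op:
  assumes "\<sigma> \<circ> \<sigma> = id"
  shows "clifford (perm_op \<sigma>)"
  unfolding clifford_def perm_op_adj[OF assms]
proof (intro conjI allI perm_op_unitary assms)
  fix q p
  have "perm_op \<sigma> ** pauli_op q p ** perm_op \<sigma> = pauli_op (q \<circ> \<sigma>) (p \<circ> \<sigma>)"
    unfolding pauli_op_weyl perm_op_tensor[OF assms] by (simp add: comp_def)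
  then show "\<exists>c q' p'. cmod c = 1 \<and> perm_op \<sigma> ** pauli_op q p ** perm_op \<sigma> = mat c ** pauli_op q' p'"
    by (intro exI[of _ 1]) auto
qed

lemma clifford_fourier: "clifford (tensor_op (\<lambda>_. F_op))"
  unfolding clifford_def
proof (intro conjI allI tensor_op_unitary F_op_unitary)
  fix q p :: "'a \<Rightarrow> 'b mod_ring"
  have "tensor_op (\<lambda>_. F_op) ** pauli_op q p ** adj (tensor_op (\<lambda>_. F_op))
    = mat (\<Prod>j\<in>UNIV. chi (p j * q j)) ** pauli_op (\<lambda>j. - p j) q"
    unfolding pauli_op_weyl tensor_op_adj tensor_op_mult F_op_weyl tensor_op_smult ..
  moreover have "cmod (\<Prod>j\<in>UNIV. chi (p j * q j)) = 1"
    by (simp add: prod_norm[symmetric] cmod_chi)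
  ultimately show "\<exists>c q' p'. cmod c = 1 \<and>
      tensor_op (\<lambda>_. F_op) ** pauli_op q p ** adj (tensor_op (\<lambda>_. F_op)) = mat c ** pauli_op q' p'"
    by blast
qed

section \<open>The projective Clifford group and its finiteness\<close>

lemma pauli_group_carrier: "pauli_group \<subseteq> carrier PU"
  unfolding pauli_group_def PU_carrier using pauli_op_unitary by auto

lemma pauli_group_image: "pauli_group = (\<lambda>(q, p). proj_class (pauli_op q p)) ` UNIV"
  unfolding pauli_group_def by auto

lemma finite_pauli_group: "finite (pauli_group :: ('n::finite, 'd::prime_card) op set set)"
  unfolding pauli_group_image by simp

lemma PU_conj:
  assumes "U \<in> carrier unitary_group"
  shows "proj_class U \<otimes>\<^bsub>PU\<^esub> proj_class (pauli_op q p) \<otimes>\<^bsub>PU\<^esub> inv\<^bsub>PU\<^esub> proj_class U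
    = proj_class (U ** pauli_op q p ** adj U)"
  using assms by (simp add: PU_inv PU_mult pauli_op_unitary unitary_mult unitary_adj)

text \<open>Conjugation is injective, so mapping the finite Pauli group into itself already means
  mapping it onto itself, as the normalizer requires.\<close>

lemma clifford_group_eq: "clifford_group = proj_class ` {U :: ('n::finite, 'd::prime_card) op. clifford U}"
proof -
  interpret PU: group PU by (rule PU_group)
  let ?f = "\<lambda>K X. K \<otimes>\<^bsub>PU\<^esub> X \<otimes>\<^bsub>PU\<^esub> inv\<^bsub>PU\<^esub> K"
  have "K <#\<^bsub>PU\<^esub> pauli_group #>\<^bsub>PU\<^esub> inv\<^bsub>PU\<^esub> K = ?f K ` pauli_group" for K :: "('n, 'd) op set"
    by (auto simp: l_coset_def r_coset_def)
  then have mem: "K \<in> clifford_group \<longleftrightarrow> K \<in> carrier PU \<and> ?f K ` pauli_group = pauli_group" for K :: "('n, 'd) op set"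
    unfolding clifford_group_def normalizer_def stabilizer_def
    by (simp add: pauli_group_carrier)
  show ?thesis
  proof (intro equalityI subsetI)
    fix K :: "('n, 'd) op set" assume K: "K \<in> clifford_group"
    then obtain U where U: "U \<in> carrier unitary_group" "K = proj_class U"
      using mem PU_carrier by blast
    have "\<exists>c q' p'. cmod c = 1 \<and> U ** pauli_op q p ** adj U = mat c ** pauli_op q' p'" for q p
    proof -
      have "?f K (proj_class (pauli_op q p)) \<in> pauli_group"
        using K mem pauli_group_def by blast
      then have "proj_class (U ** pauli_op q p ** adj U) \<in> pauli_group"
        using PU_conj[OF U(1)] U(2) by simp
      then obtain q' p' where "proj_class (U ** pauli_op q p ** adj U) = proj_class (pauli_op q' p')"
        unfolding pauli_group_def by blast
      then have "U ** pauli_op q p ** adj U \<in> proj_class (pauli_op q' p')"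
        using proj_class_self by blast
      then show ?thesis unfolding proj_class_def' by blast
    qed
    then show "K \<in> proj_class ` {U. clifford U}"
      using U by (auto simp: clifford_def)
  next
    fix K :: "('n, 'd) op set" assume "K \<in> proj_class ` {U. clifford U}"
    then obtain U where U: "clifford U" "K = proj_class U" by blast
    then have K: "K \<in> carrier PU" unfolding PU_carrier using clifford_unitary by blast
    have "?f K ` pauli_group \<subseteq> pauli_group"
    proof
      fix Y assume "Y \<in> ?f K ` pauli_group"
      then obtain q p where Y: "Y = ?f K (proj_class (pauli_op q p))" unfolding pauli_group_def by blast
      obtain c q' p' where c: "cmod c = 1" "U ** pauli_op q p ** adj U = mat c ** pauli_op q' p'"
        using U unfolding clifford_def by blast
      have "Y = proj_class (pauli_op q' p')"
        unfolding Y U(2) PU_conj[OF clifford_unitary[OF U(1)]] c(2) by (rule proj_class_phase[OF c(1)])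
      then show "Y \<in> pauli_group" unfolding pauli_group_def by blast
    qed
    moreover have "inj_on (?f K) pauli_group"
    proof (rule inj_onI)
      fix X Y :: "('n, 'd) op set"
      assume "X \<in> pauli_group" "Y \<in> pauli_group"
      then have XY: "X \<in> carrier PU" "Y \<in> carrier PU" using pauli_group_carrier by blast+
      assume "?f K X = ?f K Y"
      then have "K \<otimes>\<^bsub>PU\<^esub> X = K \<otimes>\<^bsub>PU\<^esub> Y"
        using K XY PU.right_cancel[of "inv\<^bsub>PU\<^esub> K"] by simp
      then show "X = Y" using K XY PU.Units_l_cancel[of K X Y] by (simp add: PU.Units_eq)
    qed
    ultimately show "K \<in> clifford_group"
      using mem K endo_inj_surj[OF finite_pauli_group] by blast
  qed
qed

lemma unitary_rep_clifford:
  assumes "K \<in> clifford_group"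
  shows "clifford (unitary_rep K)" "proj_class (unitary_rep K) = K"
proof -
  obtain U where U: "clifford U" "K = proj_class U" using assms clifford_group_eq by blast
  have "unitary_rep K \<in> K"
    unfolding unitary_rep_def by (rule someI[of _ U]) (simp add: U(2) proj_class_self)
  then show eq: "proj_class (unitary_rep K) = K" unfolding U(2) by (rule proj_class_eqI)
  obtain c where c: "cmod c = 1" "unitary_rep K = mat c ** U"
    using \<open>unitary_rep K \<in> K\<close> unfolding U(2) proj_class_def' by blast
  have "clifford (mat c)"
    unfolding clifford_def
  proof (intro conjI allI phase_unitary c(1))
    fix q p
    have "mat c ** pauli_op q p ** adj (mat c) = mat 1 ** pauli_op q p"
      unfolding adj_mat mat_scalar_commute[of "mat c ** pauli_op q p"] matrix_mul_assoc mat_mult_mat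
      using c(1) by (simp add: complex_norm_square[symmetric] mult.commute[of "cnj c"])
    then show "\<exists>b q' p'. cmod b = 1 \<and> mat c ** pauli_op q p ** adj (mat c) = mat b ** pauli_op q' p'"
      by (metis norm_one)
  qed
  then show "clifford (unitary_rep K)" unfolding c(2) by (rule clifford_mult[OF _ U(1)])
qed

lemma pauli_op_entry:
  "pauli_op q p $ s $ t = (if s = (\<lambda>j. t j + q j) then \<Prod>j\<in>UNIV. chi (p j * s j) else 0)"
  by (auto simp: pauli_op_weyl tensor_op_def weyl_entry fun_eq_iff prod_zero_iff)

text \<open>Commuting with Z on a single site where s and t differ kills the entry at (s, t), since
  \<open>chi\<close> is injective; commuting with the shift by s - t equates the diagonal entries at
  s and t.\<close>

lemma pauli_commutant_scalar:
  fixes W :: "('n::finite, 'd::prime_card) op"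
  assumes comm: "\<And>q p. W ** pauli_op q p = pauli_op q p ** W"
  shows "\<exists>c. W = mat c"
proof -
  have diag: "W $ s $ t = 0" if st: "s \<noteq> t" for s t
  proof -
    obtain j where j: "s j \<noteq> t j" using st by auto
    let ?p = "\<lambda>i. if i = j then 1 else 0 :: 'd mod_ring"
    have P: "pauli_op (\<lambda>_. 0) ?p $ u $ v = (if u = v then chi (u j) else 0)" for u v :: "'n \<Rightarrow> 'd mod_ring"
      by (simp add: pauli_op_entry if_distrib[of "\<lambda>x. x * _"] if_distrib[of chi] chi_0 cong: if_cong)
    have "(W ** pauli_op (\<lambda>_. 0) ?p) $ s $ t = (pauli_op (\<lambda>_. 0) ?p ** W) $ s $ t"
      using comm by simp
    then have "W $ s $ t * chi (t j) = chi (s j) * W $ s $ t"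
      by (simp add: matrix_matrix_mult_def P if_distrib[of "\<lambda>x. x * _"] if_distrib[of "\<lambda>x. _ * x"] cong: if_cong)
    then show ?thesis using j chi_inj[of "s j" "t j"] by (simp add: mult.commute)
  qed
  have const: "W $ s $ s = W $ t $ t" for s t
  proof -
    let ?q = "\<lambda>i. s i - t i"
    have P: "pauli_op ?q (\<lambda>_. 0) $ u $ v = (if u = (\<lambda>j. v j + ?q j) then 1 else 0)" for u v :: "'n \<Rightarrow> 'd mod_ring"
      by (simp add: pauli_op_entry chi_0)
    have P': "pauli_op ?q (\<lambda>_. 0) $ s $ v = (if v = t then 1 else 0)" for v :: "'n \<Rightarrow> 'd mod_ring"
      unfolding P by (auto simp: fun_eq_iff algebra_simps)
    have "(W ** pauli_op ?q (\<lambda>_. 0)) $ s $ t = (pauli_op ?q (\<lambda>_. 0) ** W) $ s $ t"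
      using comm by simp
    moreover have "(pauli_op ?q (\<lambda>_. 0) ** W) $ s $ t = W $ t $ t"
      by (simp add: matrix_matrix_mult_def P' if_distrib[of "\<lambda>x. x * _"] cong: if_cong)
    moreover have "(W ** pauli_op ?q (\<lambda>_. 0)) $ s $ t = W $ s $ s"
      by (simp add: matrix_matrix_mult_def P if_distrib[of "\<lambda>x. _ * x"] cong: if_cong)
    ultimately show ?thesis by simp
  qed
  have "W = mat (W $ (\<lambda>_. 0) $ (\<lambda>_. 0))"
    using diag const by (auto simp: vec_eq_iff mat_def)
  then show ?thesis by blast
qed

text \<open>Determinants restrict the phases in \<open>U P U\<^sup>\<dagger> = c P'\<close> to finitely many.\<close>

lemma finite_clifford_group: "finite (clifford_group :: ('n::finite, 'd::prime_card) op set set)"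
proof -
  let ?P = "\<lambda>x. pauli_op (fst x) (snd x) :: ('n, 'd) op"
  let ?D = "CARD('n \<Rightarrow> 'd mod_ring)"
  \<comment> \<open>f records how a class acts by conjugation on the Pauli operators. Finitely many
    tables of values are possible, so injectivity of f is all that remains.\<close>
  define f where "f K = (\<lambda>x. unitary_rep K ** ?P x ** adj (unitary_rep K))" for K :: "('n, 'd) op set"
  define S where "S = (\<Union>x. \<Union>y. (\<lambda>c. mat c ** ?P y) ` {c. c ^ ?D = det (?P x) / det (?P y)})"
  have det1: "det U * det (adj U) = 1" if "U \<in> carrier unitary_group" for U :: "('n, 'd) op"
  proof -
    have "det (U ** adj U) = 1" using that by (simp add: unitary_carrier)
    then show ?thesis by (simp add: det_mul)
  qed
  have finS: "finite S" unfolding S_def by (intro finite_UN_I finite_imageI finite_nth_roots) auto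
  have "f K \<in> UNIV \<rightarrow>\<^sub>E S" if "K \<in> clifford_group" for K
  proof -
    let ?U = "unitary_rep K"
    have U: "clifford ?U" by (rule unitary_rep_clifford[OF that])
    have "f K x \<in> S" for x
    proof -
      obtain c q' p' where c: "cmod c = 1" "?U ** ?P x ** adj ?U = mat c ** pauli_op q' p'"
        using U unfolding clifford_def by blast
      have "det (?U ** ?P x ** adj ?U) = det (?P x) * (det ?U * det (adj ?U))"
        by (simp add: det_mul)
      then have "c ^ ?D * det (?P (q', p')) = det (?P x)"
        unfolding c(2) by (simp add: det_mul det_mat det1[OF clifford_unitary[OF U]])
      moreover have "det (?P (q', p')) \<noteq> 0"
        using det1[OF pauli_op_unitary[of q' p']] by auto
      ultimately have "c ^ ?D = det (?P x) / det (?P (q', p'))" by (simp add: field_simps)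
      moreover have "f K x = mat c ** ?P (q', p')" using c(2) by (simp add: f_def)
      ultimately show ?thesis unfolding S_def by blast
    qed
    then show ?thesis by auto
  qed
  then have "f ` clifford_group \<subseteq> UNIV \<rightarrow>\<^sub>E S" by blast
  then have "finite (f ` clifford_group)"
    by (rule finite_subset) (intro finite_PiE finS finite)
  moreover have "inj_on f clifford_group"
  proof (rule inj_onI)
    fix K L assume K: "K \<in> clifford_group" and L: "L \<in> clifford_group" and eq: "f K = f L"
    let ?U = "unitary_rep K" and ?V = "unitary_rep L"
    have U: "?U \<in> carrier unitary_group" and V: "?V \<in> carrier unitary_group"
      using unitary_rep_clifford(1)[OF K] unitary_rep_clifford(1)[OF L] by (auto intro: clifford_unitary)
    \<comment> \<open>Equal actions put V^dagger U into the commutant of the Pauli operators, so it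
      is a scalar; unitarity makes this scalar a phase, which the projective class forgets.\<close>
    have "adj ?V ** ?U ** pauli_op q p = pauli_op q p ** (adj ?V ** ?U)" for q p
    proof -
      have e: "?U ** pauli_op q p ** adj ?U = ?V ** pauli_op q p ** adj ?V"
        using fun_cong[OF eq, of "(q, p)"] by (simp add: f_def)
      have "adj ?V ** ?U ** pauli_op q p = adj ?V ** (?U ** pauli_op q p ** adj ?U) ** ?U"
        using U by (simp add: unitary_carrier flip: matrix_mul_assoc)
      also have "\<dots> = (adj ?V ** ?V) ** pauli_op q p ** (adj ?V ** ?U)"
        unfolding e by (simp add: matrix_mul_assoc)
      finally show ?thesis using V by (simp add: unitary_carrier)
    qed
    then obtain c where c: "adj ?V ** ?U = mat c" using pauli_commutant_scalar by blast
    have "?U = ?V ** (adj ?V ** ?U)" using V by (simp add: unitary_carrier matrix_mul_assoc)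
    then have UV: "?U = mat c ** ?V" unfolding c mat_scalar_commute .
    have "mat (cnj c * c) = (mat 1 :: ('n, 'd) op)"
      using unitary_mult[OF unitary_adj[OF V] U] unfolding c unitary_carrier by (simp add: adj_mat mat_mult_mat)
    then have "mat (cnj c * c) $ s $ s = (mat 1 :: ('n, 'd) op) $ s $ s" for s by simp
    then have "cnj c * c = 1" by (simp add: mat_def)
    then have "(cmod c)\<^sup>2 = 1" by (metis complex_norm_square mult.commute of_real_1 of_real_eq_iff)
    then have "cmod c = 1" by (simp add: power2_eq_1_iff) (smt (verit) norm_ge_zero)
    then have "proj_class ?U = proj_class ?V" unfolding UV by (rule proj_class_phase)
    then show "K = L" using unitary_rep_clifford(2)[OF K] unitary_rep_clifford(2)[OF L] by simp
  qed
  ultimately show ?thesis by (rule finite_imageD)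
qed

section \<open>The circuit kernel\<close>

definition branch_op ::
  "real \<Rightarrow> 'd::prime_card mod_ring \<Rightarrow> ('n::{finite,linorder}, 'd) branch \<Rightarrow> ('n, 'd) op" where
  "branch_op \<theta> a J = adj (unitary_rep (fst J)) ** (Pi_op (snd J) ** on_first (R_op \<theta> a)) ** unitary_rep (fst J)"

text \<open>The phase of the representative occurs once as c and once as its conjugate and cancels,
  so the arbitrary choice in \<open>unitary_rep\<close> can be replaced by any explicit Clifford
  unitary.\<close>

lemma branch_op_proj_class:
  assumes "clifford U"
  shows "branch_op \<theta> a (proj_class U, m) = adj U ** (Pi_op m ** on_first (R_op \<theta> a)) ** U"
proof -
  have "unitary_rep (proj_class U) \<in> proj_class U"
    unfolding unitary_rep_def by (rule someI[of _ U]) (rule proj_class_self)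
  then obtain c where c: "cmod c = 1" "unitary_rep (proj_class U) = mat c ** U"
    unfolding proj_class_def' by blast
  have "adj (mat c ** U) ** X ** (mat c ** U) = adj U ** X ** U" for X
  proof -
    have "adj (mat c ** U) ** X ** (mat c ** U) = adj U ** (mat (cnj c) ** X ** mat c) ** U"
      by (simp add: adj_mult adj_mat matrix_mul_assoc)
    also have "mat (cnj c) ** X ** mat c = X"
      unfolding mat_scalar_commute[of "mat (cnj c) ** X"] matrix_mul_assoc mat_mult_mat
      using c(1) by (simp add: complex_norm_square[symmetric])
    finally show ?thesis .
  qed
  then show ?thesis by (simp add: branch_op_def c(2))
qed

lemma branch_op_vec:
  "branch_op \<theta> a J *v unit_rep \<psi> = adj (unitary_rep (fst J)) *v outcome_vec \<theta> a J \<psi>"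
  by (simp add: branch_op_def outcome_vec_def matrix_vector_mul_assoc matrix_mul_assoc)

lemma branch_map_op: "branch_map \<theta> a J \<psi> = ray_of (branch_op \<theta> a J *v unit_rep \<psi>)"
  by (simp add: branch_map_def branch_op_vec)

lemma unitary_rep_unitary: "K \<in> clifford_group \<Longrightarrow> unitary_rep K \<in> carrier unitary_group"
  by (rule clifford_unitary) (rule unitary_rep_clifford)

text \<open>The final inverse Clifford unitary preserves norms, so the probability and the new state
  can be read off the same vector.\<close>

lemma branch_prob_op:
  assumes "J \<in> branches"
  shows "branch_prob \<theta> a J \<psi> = (norm (branch_op \<theta> a J *v unit_rep \<psi>))\<^sup>2"
  using unitary_rep_unitary[of "fst J"] assms
  by (auto simp: branch_prob_def branch_op_vec branches_def unitary_carrier adj_adj intro!: norm_unitary[symmetric])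

section \<open>Outcome probabilities add up to one\<close>

definition outcome_proj :: "'d::prime_card mod_ring \<Rightarrow> 'd qudit_op" where
  "outcome_proj m = (\<chi> j k. if j = m \<and> k = m then 1 else 0)"

lemma Pi_op_site: "Pi_op m = site_op (Min UNIV) (outcome_proj m)"
  by (simp add: Pi_op_def on_first_site outcome_proj_def)

lemma Pi_op_vec: "(Pi_op m *v w) $ s = (if s (Min UNIV) = m then w $ s else 0)"
proof -
  have "Pi_op m $ s $ t = (if t = s \<and> s (Min UNIV) = m then 1 else 0)" for s t :: "'a \<Rightarrow> 'b mod_ring"
  proof -
    have "Pi_op m $ s $ t = (\<Prod>j\<in>UNIV. if s j = t j \<and> (j = Min UNIV \<longrightarrow> s j = m) then 1 else 0)"
      unfolding Pi_op_site site_op_def tensor_op_def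
      by (auto simp: outcome_proj_def mat_def intro!: prod.cong)
    also have "\<dots> = (if t = s \<and> s (Min UNIV) = m then 1 else 0)"
      by (auto simp: fun_eq_iff prod_zero_iff) metis
    finally show ?thesis .
  qed
  then show ?thesis
    by (simp add: matrix_vector_mult_def if_distrib[of "\<lambda>x. x * _"] cong: if_cong conj_cong)
qed

lemma norm_square_sum: "(norm w)\<^sup>2 = (\<Sum>s\<in>UNIV. (cmod (w $ s))\<^sup>2)" for w :: "complex^'i"
  by (simp add: norm_vec_def L2_set_def sum_nonneg)

text \<open>The outcomes partition the configurations by their value at the first site, so every
  coordinate is counted exactly once.\<close>

lemma sum_norm_Pi_op: "(\<Sum>m\<in>UNIV. (norm (Pi_op m *v w))\<^sup>2) = (norm w)\<^sup>2"
proof -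
  have "(\<Sum>m\<in>UNIV. (norm (Pi_op m *v w))\<^sup>2)
    = (\<Sum>m\<in>UNIV. \<Sum>s\<in>UNIV. if s (Min UNIV) = m then (cmod (w $ s))\<^sup>2 else 0)"
    unfolding norm_square_sum Pi_op_vec by (intro sum.cong) auto
  also have "\<dots> = (norm w)\<^sup>2"
    unfolding norm_square_sum by (subst sum.swap) simp
  finally show ?thesis .
qed

lemma cmod_rot_entry: "cmod (rot_entry \<theta> a k) = 1"
  by (simp add: rot_entry_def)

lemma D_op_unitary: "D_op \<theta> a \<in> carrier unitary_group"
proof -
  have "rot_entry \<theta> a k * cnj (rot_entry \<theta> a k) = 1" for k
    by (simp add: complex_norm_square[symmetric] cmod_rot_entry)
  then show ?thesis
    by (simp add: unitary_carrier vec_eq_iff matrix_matrix_mult_def adj_def D_op_def mat_def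
        if_distrib[of "\<lambda>x. x * _"] if_distrib[of cnj] mult.commute cong: if_cong)
qed

lemma R_op_unitary: "R_op \<theta> a \<in> carrier unitary_group"
  unfolding R_op_def by (intro unitary_mult unitary_adj F_op_unitary D_op_unitary)

lemma site_op_unitary: "A \<in> carrier unitary_group \<Longrightarrow> site_op i A \<in> carrier unitary_group"
  unfolding site_op_def by (intro tensor_op_unitary) (auto simp: unitary_carrier adj_mat)

lemma sum_branch_prob:
  assumes "K \<in> clifford_group"
  shows "(\<Sum>m\<in>UNIV. branch_prob \<theta> a (K, m) \<psi>) = 1"
proof -
  let ?V = "on_first (R_op \<theta> a) ** unitary_rep K"
  have "?V \<in> carrier unitary_group"
    unfolding on_first_site
    by (intro unitary_mult site_op_unitary R_op_unitary unitary_rep_unitary[OF assms])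
  then have "norm (?V *v unit_rep \<psi>) = 1"
    by (simp add: unitary_carrier norm_unitary unit_rep(1))
  then show ?thesis
    using sum_norm_Pi_op[of "?V *v unit_rep \<psi>"]
    by (simp add: branch_prob_def outcome_vec_def matrix_vector_mul_assoc matrix_mul_assoc)
qed

lemma clifford_group_nonempty: "(clifford_group :: ('n::finite, 'd::prime_card) op set set) \<noteq> {}"
proof -
  have "clifford (perm_op id)" by (rule clifford_perm_op) simp
  then show ?thesis unfolding clifford_group_eq by blast
qed

lemma card_clifford_group_pos: "0 < card (clifford_group :: ('n::finite, 'd::prime_card) op set set)"
  using clifford_group_nonempty finite_clifford_group by (simp add: card_gt_0_iff)

lemma finite_branches: "finite branches"
  unfolding branches_def by (intro finite_cartesian_product finite_clifford_group finite)

text \<open>Branches of probability zero contribute nothing. Including them makes the index set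
  independent of \<psi>, which the proof of measurability in \<psi> relies on.\<close>

lemma kernel_value_sum:
  fixes \<psi> :: "('n::{finite,linorder}, 'd::prime_card) state"
  shows "kernel_value \<theta> a \<psi> A = (\<Sum>J\<in>branches. branch_prob \<theta> a J \<psi> * indicator A (branch_map \<theta> a J \<psi>))
    / card (clifford_group :: ('n, 'd) op set set)"
proof -
  have "branch_prob \<theta> a J \<psi> \<ge> 0" for J by (simp add: branch_prob_def)
  then have "(\<Sum>J\<in>{J \<in> branches. branch_prob \<theta> a J \<psi> > 0}. branch_prob \<theta> a J \<psi> * indicator A (branch_map \<theta> a J \<psi>))
    = (\<Sum>J\<in>branches. branch_prob \<theta> a J \<psi> * indicator A (branch_map \<theta> a J \<psi>))"
    by (intro sum.mono_neutral_left finite_branches) (auto simp: order.order_iff_strict)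
  then show ?thesis unfolding kernel_value_def by simp
qed

text \<open>\<open>measure_of\<close> returns the intended values only for a countably additive set
  function. This is secured by identifying the kernel with the image under the branch map of a
  weighted point measure on the finite set of branches.\<close>

lemma
  fixes \<psi> :: "('n::{finite,linorder}, 'd::prime_card) state"
  shows sets_circuit_kernel: "sets (circuit_kernel \<theta> a \<psi>) = sets borel"
    and emeasure_circuit_kernel:
      "A \<in> sets borel \<Longrightarrow> emeasure (circuit_kernel \<theta> a \<psi>) A = ennreal (kernel_value \<theta> a \<psi> A)"
proof -
  let ?c = "card (clifford_group :: ('n, 'd) op set set)"
  define \<kappa> where "\<kappa> = distr (point_measure branches (\<lambda>J. ennreal (branch_prob \<theta> a J \<psi> / ?c))) borel
    (\<lambda>J. branch_map \<theta> a J \<psi>)"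
  have e: "emeasure \<kappa> A = ennreal (kernel_value \<theta> a \<psi> A)" if A: "A \<in> sets borel" for A
  proof -
    have "emeasure \<kappa> A = (\<Sum>J\<in>{J \<in> branches. branch_map \<theta> a J \<psi> \<in> A}. ennreal (branch_prob \<theta> a J \<psi> / ?c))"
      unfolding \<kappa>_def using A
      by (subst emeasure_distr) (auto simp: measurable_point_measure_eq1 space_point_measure vimage_def
          Int_def conj_commute finite_branches intro!: emeasure_point_measure_finite)
    also have "\<dots> = ennreal (\<Sum>J\<in>{J \<in> branches. branch_map \<theta> a J \<psi> \<in> A}. branch_prob \<theta> a J \<psi> / ?c)"
      by (rule sum_ennreal) (simp add: branch_prob_def)
    also have "(\<Sum>J\<in>{J \<in> branches. branch_map \<theta> a J \<psi> \<in> A}. branch_prob \<theta> a J \<psi> / ?c) = kernel_value \<theta> a \<psi> A"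
      unfolding kernel_value_sum sum_divide_distrib
      by (rule sum.mono_neutral_cong_left) (auto simp: finite_branches)
    finally show ?thesis .
  qed
  have "sets \<kappa> = sets borel" "space \<kappa> = UNIV" by (simp_all add: \<kappa>_def)
  then have "circuit_kernel \<theta> a \<psi> = measure_of (space \<kappa>) (sets \<kappa>) (emeasure \<kappa>)"
    unfolding circuit_kernel_def using e
    by (simp only:) (rule measure_of_eq, use sets.sigma_sets_eq[of "borel :: ('n, 'd) state measure"] in auto)
  then have "circuit_kernel \<theta> a \<psi> = \<kappa>" unfolding measure_of_of_measure .
  then show "sets (circuit_kernel \<theta> a \<psi>) = sets borel"
    "A \<in> sets borel \<Longrightarrow> emeasure (circuit_kernel \<theta> a \<psi>) A = ennreal (kernel_value \<theta> a \<psi> A)"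
    using e \<open>sets \<kappa> = sets borel\<close> by auto
qed

lemma measurable_circuit_kernel:
  "circuit_kernel \<theta> a \<in> borel \<rightarrow>\<^sub>M prob_algebra (borel :: ('n::{finite,linorder}, 'd::prime_card) state measure)"
proof (rule measurable_prob_algebraI)
  let ?C = "clifford_group :: ('n, 'd) op set set"
  have total: "kernel_value \<theta> a \<psi> UNIV = 1" for \<psi> :: "('n, 'd) state"
  proof -
    have "(\<Sum>J\<in>branches. branch_prob \<theta> a J \<psi>) = (\<Sum>K\<in>?C. \<Sum>m\<in>UNIV. branch_prob \<theta> a (K, m) \<psi>)"
      unfolding branches_def by (simp add: sum.cartesian_product case_prod_beta)
    also have "\<dots> = card ?C" by (simp add: sum_branch_prob)
    finally show ?thesis using card_clifford_group_pos[where 'n='n and 'd='d] by (simp add: kernel_value_sum)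
  qed
  show p: "prob_space (circuit_kernel \<theta> a \<psi>)" for \<psi> :: "('n, 'd) state"
    using sets_eq_imp_space_eq[OF sets_circuit_kernel[of \<theta> a \<psi>]]
    by (intro prob_spaceI) (simp add: emeasure_circuit_kernel total)
  show "circuit_kernel \<theta> a \<in> borel \<rightarrow>\<^sub>M subprob_algebra (borel :: ('n, 'd) state measure)"
  proof (rule measurable_subprob_algebra)
    fix A :: "('n, 'd) state set" assume A: "A \<in> sets borel"
    have "(\<lambda>\<psi>. \<Sum>J\<in>branches. branch_prob \<theta> a J \<psi> * indicator A (branch_map \<theta> a J \<psi>) :: real) \<in> borel_measurable borel"
    proof (rule borel_measurable_sum)
      fix J :: "('n, 'd) branch" assume "J \<in> branches"
      then show "(\<lambda>\<psi>. branch_prob \<theta> a J \<psi> * indicator A (branch_map \<theta> a J \<psi>) :: real) \<in> borel_measurable borel"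
        using measurable_matrix_branch[OF A] by (simp add: branch_prob_op branch_map_op)
    qed
    then show "(\<lambda>\<psi>. emeasure (circuit_kernel \<theta> a \<psi>) A) \<in> borel_measurable borel"
      by (simp add: emeasure_circuit_kernel[OF A] kernel_value_sum)
  qed (use p in \<open>auto simp: sets_circuit_kernel prob_space_imp_subprob_space\<close>)
qed

section \<open>A state reached uniformly from everywhere\<close>

text \<open>Keeps only the path through y, dropping all other contributions to the mass at
  z.\<close>

lemma measure_bind_atom:
  assumes \<nu>: "\<nu> \<in> space (prob_algebra M)" and K: "K \<in> M \<rightarrow>\<^sub>M prob_algebra L"
    and y: "{y} \<in> sets M" and z: "{z} \<in> sets L"
  shows "measure \<nu> {y} * measure (K y) {z} \<le> measure (\<nu> \<bind> K) {z}"
proof -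
  have yM: "y \<in> space M" using sets.sets_into_space[OF y] by auto
  have "K y \<in> space (prob_algebra L)" by (rule measurable_space[OF K yM])
  moreover have "\<nu> \<bind> K \<in> space (prob_algebra L)" by (rule bind_in_prob_algebra[OF \<nu> K])
  ultimately interpret N: prob_space \<nu> + Ky: prob_space "K y" + B: prob_space "\<nu> \<bind> K"
    using \<nu> by (auto simp: space_prob_algebra)
  have y': "{y} \<in> sets \<nu>" using \<nu> y by (simp add: space_prob_algebra)
  have "emeasure (K y) {z} * emeasure \<nu> {y} = (\<integral>\<^sup>+ x. emeasure (K y) {z} * indicator {y} x \<partial>\<nu>)"
    using y' by (simp add: nn_integral_cmult_indicator)
  also have "\<dots> \<le> (\<integral>\<^sup>+ x. emeasure (K x) {z} \<partial>\<nu>)"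
    by (intro nn_integral_mono) (auto split: split_indicator)
  also have "\<dots> = emeasure (\<nu> \<bind> K) {z}"
    by (rule emeasure_bind_prob_algebra[OF \<nu> K z, symmetric])
  finally show ?thesis
    by (simp add: N.emeasure_eq_measure Ky.emeasure_eq_measure B.emeasure_eq_measure mult.commute
        flip: ennreal_mult)
qed

text \<open>Only an inequality, because other branches may lead to the same ray. The vector w is not
  normalised, whence the quotient of norms; this makes the bounds for successive steps multiply
  cleanly.\<close>

lemma circuit_kernel_atom:
  fixes w :: "complex^('n::{finite,linorder} \<Rightarrow> 'd::prime_card mod_ring)"
  assumes J: "J \<in> branches" and w: "branch_op \<theta> a J *v w \<noteq> 0"
  shows "(norm (branch_op \<theta> a J *v w))\<^sup>2 / (norm w)\<^sup>2 / card (clifford_group :: ('n, 'd) op set set)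
    \<le> measure (circuit_kernel \<theta> a (ray_of w)) {ray_of (branch_op \<theta> a J *v w)}"
proof -
  let ?B = "branch_op \<theta> a J" and ?c = "card (clifford_group :: ('n, 'd) op set set)"
  let ?z = "ray_of (?B *v w)"
  have "w \<noteq> 0" using w by auto
  then obtain c where c: "unit_rep (ray_of w) = c *s w" "cmod c = 1 / norm w" by (rule unit_rep_ray_of)
  have "c \<noteq> 0" using c(2) \<open>w \<noteq> 0\<close> by auto
  have Bv: "?B *v unit_rep (ray_of w) = c *s (?B *v w)" by (simp add: c(1) vector_scalar_commute)
  have z: "branch_map \<theta> a J (ray_of w) = ?z"
    unfolding branch_map_op Bv by (rule ray_of_smult[OF \<open>c \<noteq> 0\<close> w])
  have p: "branch_prob \<theta> a J (ray_of w) = (norm (?B *v w))\<^sup>2 / (norm w)\<^sup>2"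
    unfolding branch_prob_op[OF J] Bv norm_smult c(2) by (simp add: power_divide)
  have "branch_prob \<theta> a J (ray_of w) * indicator {?z} (branch_map \<theta> a J (ray_of w))
    \<le> (\<Sum>J\<in>branches. branch_prob \<theta> a J (ray_of w) * indicator {?z} (branch_map \<theta> a J (ray_of w)))"
    by (rule member_le_sum[OF J]) (auto simp: finite_branches branch_prob_def)
  then have "(norm (?B *v w))\<^sup>2 / (norm w)\<^sup>2 / ?c \<le> kernel_value \<theta> a (ray_of w) {?z}"
    unfolding kernel_value_sum by (intro divide_right_mono) (auto simp: p z)
  moreover have "0 \<le> kernel_value \<theta> a (ray_of w) {?z}"
    unfolding kernel_value_sum by (intro divide_nonneg_nonneg sum_nonneg) (auto simp: branch_prob_def)
  ultimately show ?thesis by (simp add: measure_def emeasure_circuit_kernel)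
qed

section \<open>Products of branch operators as paths of the chain\<close>

primrec branch_products ::
  "real \<Rightarrow> 'd::prime_card mod_ring \<Rightarrow> nat \<Rightarrow> ('n::{finite,linorder}, 'd) op set" where
  "branch_products \<theta> a 0 = {mat 1}"
| "branch_products \<theta> a (Suc k) = {branch_op \<theta> a J ** A | J A. J \<in> branches \<and> A \<in> branch_products \<theta> a k}"

lemma circuit_step_in_prob_algebra:
  "\<mu> \<in> space (prob_algebra borel) \<Longrightarrow> (circuit_step \<theta> a ^^ k) \<mu> \<in> space (prob_algebra borel)"
  by (induction k) (auto simp: circuit_step_def intro: bind_in_prob_algebra[OF _ measurable_circuit_kernel])

text \<open>Along a path the intermediate norms telescope, so only the norm of the final vector
  remains, together with one factor 1 / |C| for each uniformly chosen Clifford element.\<close>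

lemma branch_products_atom:
  fixes x :: "('n::{finite,linorder}, 'd::prime_card) state"
  assumes "A \<in> branch_products \<theta> a k" "A *v unit_rep x \<noteq> 0"
  shows "(norm (A *v unit_rep x))\<^sup>2 / real (card (clifford_group :: ('n, 'd) op set set)) ^ k
    \<le> measure ((circuit_step \<theta> a ^^ k) (return borel x)) {ray_of (A *v unit_rep x)}"
  using assms
proof (induction k arbitrary: A)
  case 0
  then show ?case by (simp add: unit_rep measure_return)
next
  case (Suc k)
  let ?c = "real (card (clifford_group :: ('n, 'd) op set set))"
  let ?\<nu> = "(circuit_step \<theta> a ^^ k) (return borel x)"
  obtain J B where A: "A = branch_op \<theta> a J ** B" "J \<in> branches" "B \<in> branch_products \<theta> a k"
    using Suc.prems(1) by auto
  let ?w = "B *v unit_rep x"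
  have Aw: "A *v unit_rep x = branch_op \<theta> a J *v ?w" by (simp add: A(1) matrix_vector_mul_assoc)
  then have nz: "branch_op \<theta> a J *v ?w \<noteq> 0" using Suc.prems(2) by simp
  then have w: "?w \<noteq> 0" by auto
  have \<nu>: "?\<nu> \<in> space (prob_algebra borel)"
    by (rule circuit_step_in_prob_algebra) (simp add: space_prob_algebra prob_space_return)
  have "(norm (A *v unit_rep x))\<^sup>2 / ?c ^ Suc k
    = ((norm ?w)\<^sup>2 / ?c ^ k) * ((norm (branch_op \<theta> a J *v ?w))\<^sup>2 / (norm ?w)\<^sup>2 / ?c)"
    using w by (simp add: Aw)
  also have "\<dots> \<le> measure ?\<nu> {ray_of ?w} * measure (circuit_kernel \<theta> a (ray_of ?w)) {ray_of (branch_op \<theta> a J *v ?w)}"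
    by (intro mult_mono Suc.IH[OF A(3) w] circuit_kernel_atom[OF A(2) nz]) auto
  also have "\<dots> \<le> measure (?\<nu> \<bind> circuit_kernel \<theta> a) {ray_of (branch_op \<theta> a J *v ?w)}"
    by (rule measure_bind_atom[OF \<nu> measurable_circuit_kernel]) auto
  also have "?\<nu> \<bind> circuit_kernel \<theta> a = (circuit_step \<theta> a ^^ Suc k) (return borel x)"
    by (simp add: circuit_step_def[of \<theta> a ?\<nu>])
  finally show ?case unfolding Aw .
qed

lemma site_branch:
  fixes i :: "'n::{finite,linorder}"
  shows "\<exists>J\<in>branches. branch_op \<theta> a J = site_op i (outcome_proj m ** R_op \<theta> a)"
    and "\<exists>J\<in>branches. branch_op \<theta> a J = site_op i (adj F_op ** (outcome_proj m ** R_op \<theta> a) ** F_op)"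
proof -
  let ?P = "perm_op (Transposition.transpose (Min UNIV) i) :: ('n, 'a) op"
  let ?F = "tensor_op (\<lambda>_. F_op) :: ('n, 'a) op"
  have inv: "Transposition.transpose (Min UNIV) i \<circ> Transposition.transpose (Min UNIV) i = id"
    by (simp add: transpose_comp_involutory)
  have P: "clifford ?P" by (rule clifford_perm_op[OF inv])
  then have FP: "clifford (?F ** ?P)" by (rule clifford_mult[OF clifford_fourier])
  have mem: "(proj_class U, m) \<in> branches" if "clifford U" for U :: "('n, 'a) op"
    using that by (auto simp: branches_def clifford_group_eq)
  have "branch_op \<theta> a (proj_class ?P, m) = site_op i (outcome_proj m ** R_op \<theta> a)"
    unfolding branch_op_proj_class[OF P] perm_op_adj[OF inv]
    by (simp add: Pi_op_site on_first_site site_op_mult site_op_conj_transpose)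
  with mem[OF P] show "\<exists>J\<in>branches. branch_op \<theta> a J = site_op i (outcome_proj m ** R_op \<theta> a)" by blast
  \<comment> \<open>On the other sites F^dagger F is the identity, so a Fourier transform of all
    sites still yields an operator on site j alone.\<close>
  have F: "adj ?F ** site_op j A ** ?F = site_op j (adj F_op ** A ** F_op)" for j A
    unfolding site_op_def tensor_op_adj tensor_op_mult
    using F_op_unitary[where 'd='a] by (intro arg_cong[where f=tensor_op]) (auto simp: unitary_carrier)
  have "branch_op \<theta> a (proj_class (?F ** ?P), m)
    = ?P ** (adj ?F ** site_op (Min UNIV) (outcome_proj m ** R_op \<theta> a) ** ?F) ** ?P"
    unfolding branch_op_proj_class[OF FP]
    by (simp add: Pi_op_site on_first_site site_op_mult adj_mult perm_op_adj[OF inv] matrix_mul_assoc)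
  also have "\<dots> = site_op i (adj F_op ** (outcome_proj m ** R_op \<theta> a) ** F_op)"
    unfolding F site_op_conj_transpose ..
  finally show "\<exists>J\<in>branches. branch_op \<theta> a J = site_op i (adj F_op ** (outcome_proj m ** R_op \<theta> a) ** F_op)"
    using mem[OF FP] by blast
qed

text \<open>Operators on distinct sites multiply to a tensor product, at the price of one step per
  site. The factor X is what happened before, which allows one round to be put on top of
  another.\<close>

lemma tensor_branch_products:
  assumes "finite I" "\<And>i. i \<in> I \<Longrightarrow> \<exists>J\<in>branches. branch_op \<theta> a J = site_op i (A i)"
    and "X \<in> branch_products \<theta> a k"
  shows "tensor_op (\<lambda>i. if i \<in> I then A i else mat 1) ** X \<in> branch_products \<theta> a (card I + k)"
  using assms(1,2)
proof (induction I rule: finite_induct)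
  case empty
  then show ?case using assms(3) by (simp add: tensor_op_id)
next
  case (insert i I)
  obtain J where J: "J \<in> branches" "branch_op \<theta> a J = site_op i (A i)" using insert.prems by blast
  have "site_op i (A i) ** tensor_op (\<lambda>j. if j \<in> I then A j else mat 1)
    = tensor_op (\<lambda>j. if j \<in> insert i I then A j else mat 1)"
    unfolding site_op_def tensor_op_mult using insert.hyps(2) by (intro arg_cong[where f=tensor_op]) auto
  then have eq: "tensor_op (\<lambda>j. if j \<in> insert i I then A j else mat 1) ** X
    = branch_op \<theta> a J ** (tensor_op (\<lambda>j. if j \<in> I then A j else mat 1) ** X)"
    by (simp add: J(2) matrix_mul_assoc)
  have "tensor_op (\<lambda>j. if j \<in> I then A j else mat 1) ** X \<in> branch_products \<theta> a (card I + k)"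
    using insert by blast
  then have "tensor_op (\<lambda>j. if j \<in> insert i I then A j else mat 1) ** X \<in> branch_products \<theta> a (Suc (card I + k))"
    unfolding eq branch_products.simps using J(1) by blast
  then show ?case using insert.hyps by (simp del: branch_products.simps)
qed

text \<open>Since \<open>R F = F\<^sup>\<dagger> D F\<^sup>2\<close> and \<open>F\<^sup>2\<close> is the parity \<open>|m\<rangle> \<mapsto> |-m\<rangle>\<close>, no entry of \<open>R F\<close> vanishes, for any angle.\<close>

lemma R_op_F_op_nonzero: "(R_op \<theta> a ** F_op) $ j $ k \<noteq> 0"
proof -
  have FF: "(F_op ** F_op) $ l $ k = (if l = - k then 1 else 0)" for l
  proof -
    have "(F_op ** F_op) $ l $ k = (\<Sum>m\<in>UNIV. chi ((l + k) * m)) / of_nat CARD('a)"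
      by (simp add: matrix_matrix_mult_def F_op_entry sqrt_card_square sum_divide_distrib algebra_simps
          chi_add)
    then show ?thesis by (auto simp: chi_sum add_eq_0_iff2)
  qed
  have "(R_op \<theta> a ** F_op) = adj F_op ** D_op \<theta> a ** (F_op ** F_op)"
    by (simp add: R_op_def matrix_mul_assoc)
  also have "\<dots> $ j $ k = cnj (F_op $ (- k) $ j) * rot_entry \<theta> a (- k)"
    by (subst matrix_matrix_mult_def)
       (simp add: FF, simp add: matrix_matrix_mult_def adj_def D_op_def if_distrib[of "\<lambda>x. _ * x"] cong: if_cong)
  also have "\<dots> \<noteq> 0"
    using cmod_rot_entry[of \<theta> a "- k"] by (auto simp: F_op_entry chi_nonzero)
  finally show ?thesis .
qed

text \<open>The largest squared entry is at least the average.\<close>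

lemma exists_large_entry:
  fixes w :: "complex^'i::finite"
  shows "\<exists>m. (norm w)\<^sup>2 / CARD('i) \<le> (cmod (w $ m))\<^sup>2"
proof (rule ccontr)
  assume "\<not> ?thesis"
  then have "(\<Sum>m\<in>UNIV. (cmod (w $ m))\<^sup>2) < (\<Sum>m\<in>(UNIV :: 'i set). (norm w)\<^sup>2 / CARD('i))"
    by (intro sum_strict_mono) (auto simp: not_le)
  then show False by (simp add: norm_square_sum)
qed

lemma uniform_atom:
  fixes a :: "'d::prime_card mod_ring"
  shows "\<exists>u \<epsilon>. 0 < \<epsilon> \<and> \<epsilon> < 1 \<and> (\<forall>x :: ('n::{finite,linorder}, 'd) state.
    \<epsilon> \<le> measure ((circuit_step \<theta> a ^^ (2 * CARD('n))) (return borel x)) {u})"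
proof -
  let ?R = "R_op \<theta> a"
  let ?c = "real (card (clifford_group :: ('n, 'd) op set set))"
  let ?N = "CARD('n)" and ?D = "CARD('n \<Rightarrow> 'd mod_ring)"
  let ?G = "adj F_op ** (outcome_proj 0 ** ?R) ** F_op"
  let ?B = "tensor_op (\<lambda>_. ?G) :: ('n, 'd) op"
  \<comment> \<open>e is the N-fold tensor power of F^dagger |0>, and \<open>?G\<close> is the
    rank-one operator F^dagger |0><0| R F.\<close>
  define e :: "complex^('n \<Rightarrow> 'd mod_ring)" where "e = (\<chi> s. \<Prod>i\<in>UNIV. cnj (F_op $ 0 $ s i))"
  \<comment> \<open>The amplitude with which \<open>?B\<close> sends the basis vector of m to e,
    namely the entry of the N-fold tensor power of R F in row 0 and column m.\<close>
  define g where "g m = (\<Prod>i\<in>UNIV. (?R ** F_op) $ 0 $ m i)" for m :: "'n \<Rightarrow> 'd mod_ring"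
  have e: "e \<noteq> 0"
  proof -
    have "e $ (\<lambda>_. 0) \<noteq> 0" by (auto simp: e_def F_op_entry chi_nonzero prod_zero_iff)
    then show ?thesis by auto
  qed
  have g: "g m \<noteq> 0" for m using R_op_F_op_nonzero by (auto simp: g_def prod_zero_iff)
  have G: "?G $ j $ k = cnj (F_op $ 0 $ j) * (?R ** F_op) $ 0 $ k" for j k
  proof -
    have "?G = adj F_op ** (outcome_proj 0 ** (?R ** F_op))" by (simp add: matrix_mul_assoc)
    moreover have "(outcome_proj 0 ** X) $ l $ k = (if l = 0 then X $ 0 $ k else 0)" for l and X :: "'d qudit_op"
      by (simp add: outcome_proj_def matrix_matrix_mult_def if_distrib[of "\<lambda>x. x * _"] cong: if_cong conj_cong)
    moreover have "(adj F_op ** Y) $ j $ k = (\<Sum>l\<in>UNIV. cnj (F_op $ l $ j) * Y $ l $ k)" for Y :: "'d qudit_op"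
      by (simp add: matrix_matrix_mult_def adj_def)
    ultimately show ?thesis
      by (simp add: if_distrib[of "\<lambda>x. _ * x"] cong: if_cong)
  qed
  have B: "?B $ s $ m = g m * e $ s" for s m
    by (simp add: tensor_op_def G e_def g_def prod.distrib mult.commute)
  \<comment> \<open>The cap 1/2 ensures \<epsilon> < 1. The factor 1/D bounds the weight of the best
    outcome string of the first round, the minimum and the norm of e bound the second round whatever
    that string was, and the power of \<open>?c\<close> accounts for choosing the right Clifford
    element in all 2N steps.\<close>
  define \<epsilon> where "\<epsilon> = min (1 / 2) ((Min (range (\<lambda>m. (cmod (g m))\<^sup>2)) * (norm e)\<^sup>2 / ?D) / ?c ^ (2 * ?N))"
  have c: "?c > 0" using card_clifford_group_pos by simp
  have gmin: "0 < Min (range (\<lambda>m. (cmod (g m))\<^sup>2))" using g by (subst Min_gr_iff) auto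
  have "0 < \<epsilon>" unfolding \<epsilon>_def using gmin e c by (auto intro!: divide_pos_pos mult_pos_pos)
  moreover have "\<epsilon> < 1" by (simp add: \<epsilon>_def)
  moreover have "\<epsilon> \<le> measure ((circuit_step \<theta> a ^^ (2 * ?N)) (return borel x)) {ray_of e}" for x :: "('n, 'd) state"
  proof -
    let ?RN = "tensor_op (\<lambda>_. ?R) :: ('n, 'd) op"
    let ?w = "?RN *v unit_rep x"
    have "?RN \<in> carrier unitary_group" by (intro tensor_op_unitary R_op_unitary)
    then have "norm ?w = 1" by (simp add: unitary_carrier norm_unitary unit_rep(1))
    \<comment> \<open>The string m depends on x, so the bound below uses the minimum of |g|^2 over
      all strings, while the target ray does not involve m.\<close>
    then obtain m where m: "1 / ?D \<le> (cmod (?w $ m))\<^sup>2" using exists_large_entry[of ?w] by auto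
    then have wm: "?w $ m \<noteq> 0" by (auto simp: field_simps)
    let ?A = "tensor_op (\<lambda>i. outcome_proj (m i) ** ?R) :: ('n, 'd) op"
    have A: "(?A *v unit_rep x) $ s = (if s = m then ?w $ m else 0)" for s
    proof -
      have "tensor_op (\<lambda>i. outcome_proj (m i)) $ s $ t = (if t = m \<and> s = m then 1 else 0)" for t
        by (auto simp: tensor_op_def outcome_proj_def fun_eq_iff prod_zero_iff)
      moreover have "?A *v unit_rep x = tensor_op (\<lambda>i. outcome_proj (m i)) *v ?w"
        by (simp add: matrix_vector_mul_assoc tensor_op_mult)
      ultimately show ?thesis
        by (simp add: matrix_vector_mult_def[of "tensor_op (\<lambda>i. outcome_proj (m i))"]
            if_distrib[of "\<lambda>x. x * _"] cong: if_cong conj_cong)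
    qed
    have BA: "(?B ** ?A) *v unit_rep x = (g m * ?w $ m) *s e"
    proof -
      have "(?B ** ?A) *v unit_rep x = ?B *v (?A *v unit_rep x)" by (simp add: matrix_vector_mul_assoc)
      also have "\<dots> = (g m * ?w $ m) *s e"
        by (simp add: vec_eq_iff matrix_vector_mult_def[of ?B] A B if_distrib[of "\<lambda>x. _ * x"] mult_ac cong: if_cong)
      finally show ?thesis .
    qed
    have s1: "\<exists>J\<in>branches. branch_op \<theta> a J = site_op i (outcome_proj (m i) ** ?R)" for i :: 'n
      by (rule site_branch(1))
    have s2: "\<exists>J\<in>branches. branch_op \<theta> a J = site_op i ?G" for i :: 'n
      by (rule site_branch(2))
    have "?A \<in> branch_products \<theta> a ?N"
      using tensor_branch_products[OF finite_class.finite_UNIV s1, of "mat 1" 0] by simp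
    then have prod: "?B ** ?A \<in> branch_products \<theta> a (2 * ?N)"
      using tensor_branch_products[OF finite_class.finite_UNIV s2, of ?A ?N] by (simp add: mult_2)
    have nz: "g m * ?w $ m \<noteq> 0" using g wm by simp
    then have "(?B ** ?A) *v unit_rep x \<noteq> 0" unfolding BA using e by simp
    from branch_products_atom[OF prod this]
    have le: "(cmod (g m * ?w $ m))\<^sup>2 * (norm e)\<^sup>2 / ?c ^ (2 * ?N)
      \<le> measure ((circuit_step \<theta> a ^^ (2 * ?N)) (return borel x)) {ray_of e}"
      unfolding BA norm_smult ray_of_smult[OF nz e] by (simp add: power_mult_distrib)
    have "Min (range (\<lambda>m. (cmod (g m))\<^sup>2)) * (1 / ?D) \<le> (cmod (g m))\<^sup>2 * (cmod (?w $ m))\<^sup>2"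
      using m by (intro mult_mono Min_le) auto
    then have "(Min (range (\<lambda>m. (cmod (g m))\<^sup>2)) * (1 / ?D)) * (norm e)\<^sup>2 \<le> (cmod (g m * ?w $ m))\<^sup>2 * (norm e)\<^sup>2"
      by (intro mult_right_mono) (auto simp: norm_mult power_mult_distrib)
    then have "(Min (range (\<lambda>m. (cmod (g m))\<^sup>2)) * (norm e)\<^sup>2 / ?D) / ?c ^ (2 * ?N)
      \<le> (cmod (g m * ?w $ m))\<^sup>2 * (norm e)\<^sup>2 / ?c ^ (2 * ?N)"
      using c by (intro divide_right_mono) (auto simp: mult_ac)
    then show ?thesis using le unfolding \<epsilon>_def by linarith
  qed
  ultimately show ?thesis by blast
qed

theorem theoremB3:
  fixes \<theta> :: real and a :: "'d::prime_card mod_ring"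
  assumes "0 \<le> \<theta>" and "\<theta> \<le> 1" and "a \<noteq> 0"
  shows "\<exists>\<pi> :: ('n::{finite,linorder}, 'd) state measure.
    (\<pi> \<in> space (prob_algebra borel) \<and> circuit_step \<theta> a \<pi> = \<pi>) \<and>
    (\<forall>\<pi>' \<in> space (prob_algebra borel). circuit_step \<theta> a \<pi>' = \<pi>' \<longrightarrow> \<pi>' = \<pi>) \<and>
    (\<exists>C > 0. \<exists>l. 0 < l \<and> l < 1 \<and>
      (\<forall>\<mu> \<in> space (prob_algebra borel). \<forall>n::nat.
        W1 ((circuit_step \<theta> a ^^ n) \<mu>) \<pi> \<le> ennreal (C * l ^ n)))"
proof -
  have step: "circuit_step \<theta> a = (\<lambda>\<mu> :: ('n, 'd) state measure. \<mu> \<bind> circuit_kernel \<theta> a)"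
    by (simp add: fun_eq_iff circuit_step_def)
  obtain u :: "('n, 'd) state" and \<epsilon> where "0 < \<epsilon>" "\<epsilon> < 1"
    "\<And>x. \<epsilon> \<le> measure ((circuit_step \<theta> a ^^ (2 * CARD('n))) (return borel x)) {u}"
    using uniform_atom[where 'n='n, of \<theta> a] by blast
  then show ?thesis
    unfolding step
    by (intro uniform_atom_geometric_ergodicity[where n = "2 * CARD('n)" and \<epsilon> = \<epsilon> and u = u]
        measurable_circuit_kernel measurable_dist_ray dist_ray_le_1) auto
qed

end
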